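(* Let $d\ge2$, $c\ge0$, and let $u_{klm}$ be the Dirichlet eigenfunctions of $L$ in the unit ball $\Omega_{\mathrm{ball}}=\{x\in\mathbb{R}^d:|x|<1\}$ defined in the context. For $r>0,\epsilon>0$ let $D(r,\epsilon)=\{x\in\mathbb{R}^d:\,||x|-r|\ge\epsilon\}$. Then for every $\epsilon>0$ and every $w>0$, as $l,k\to\infty$ with $l/k\to w$ (and $m$ arbitrary with $1\le m\le\dim H_l$), $$\frac{\|u_{klm}\|_{L^\infty(D(1/h(w),\epsilon)\cap\Omega_{\mathrm{ball}})}}{\|u_{klm}\|_{L^\infty(\Omega_{\mathrm{ball}})}}\to0 .$$
   Context: $L u=-\Delta u+\frac{c^2}{|x|^2}u$ on $\mathbb{R}^d$, $d\ge2$, $c\ge0$. Set $\nu_l=\sqrt{(l+\tfrac d2-1)^2+c^2}$. $J_\nu$ is the Bessel function of the first kind of order $\nu$ and $j_{\nu,k}$ its $k$-th positive zero. $H_l$ is the space of spherical harmonics of degree $l$ on $S^{d-1}$ and $\{Y_{lm}:1\le m\le\dim H_l\}$ is an orthonormal basis of $H_l$. In spherical coordinates $x=r\xi$, $r=|x|$, $\xi\in S^{d-1}$, the Dirichlet eigenfunctions of $L$ in the unit ball are $u_{klm}(r,\xi)=r^{1-d/2}J_{\nu_l}(j_{\nu_l,k}r)Y_{lm}(\xi)$, $k\ge1$, $l\ge0$, with eigenvalues $j_{\nu_l,k}^2$. For $w>0$, $h(w)>1$ is the unique solution of $\sqrt{h^2-1}-\arccos(1/h)=\pi/w$. *)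

theory Defs
  imports "HOL-Analysis.Analysis"
begin

definition bessel_J :: "real \<Rightarrow> real \<Rightarrow> real" where
  "bessel_J nu x = (\<Sum>m. (-1) ^ m / (fact m * Gamma (real m + nu + 1)) * (x / 2) powr nu * (x / 2) ^ (2 * m))"

definition bessel_zero :: "real \<Rightarrow> nat \<Rightarrow> real" where
  "bessel_zero nu k = (THE z. 0 < z \<and> bessel_J nu z = 0 \<and>
        card {y. 0 < y \<and> y \<le> z \<and> bessel_J nu y = 0} = k)"

definition nu_l :: "nat \<Rightarrow> real \<Rightarrow> nat \<Rightarrow> real" where
  "nu_l d c l = sqrt ((real l + real d / 2 - 1)^2 + c^2)"

definition laplacian :: "(real ^ 'd \<Rightarrow> real) \<Rightarrow> real ^ 'd \<Rightarrow> real" where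
  "laplacian p x = (\<Sum>i\<in>UNIV. deriv (\<lambda>s. deriv (\<lambda>t. p (x + t *\<^sub>R axis i 1)) s) 0)"

definition homogeneous_poly :: "nat \<Rightarrow> (real ^ 'd \<Rightarrow> real) \<Rightarrow> bool" where
  "homogeneous_poly l p \<longleftrightarrow> (\<exists>(A :: ('d \<Rightarrow> nat) set) (a :: ('d \<Rightarrow> nat) \<Rightarrow> real).
      finite A \<and> (\<forall>\<alpha>\<in>A. (\<Sum>i\<in>UNIV. \<alpha> i) = l) \<and>
      p = (\<lambda>x. \<Sum>\<alpha>\<in>A. a \<alpha> * (\<Prod>i\<in>UNIV. (x $ i) ^ (\<alpha> i))))"

text \<open>H_l: spherical harmonics of degree l, i.e. restrictions to the unit sphere of
  harmonic homogeneous polynomials of degree l (functions are compared on the sphere only).\<close>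
definition spherical_harmonics :: "nat \<Rightarrow> (real ^ 'd \<Rightarrow> real) set" where
  "spherical_harmonics l = {Y. \<exists>p. homogeneous_poly l p \<and> (\<forall>x. laplacian p x = 0) \<and>
      (\<forall>x\<in>sphere 0 1. Y x = p x)}"

definition h_fun :: "real \<Rightarrow> real" where
  "h_fun w = (THE h. h > 1 \<and> sqrt (h^2 - 1) - arccos (1 / h) = pi / w)"

definition eigfun :: "real \<Rightarrow> nat \<Rightarrow> nat \<Rightarrow> (real ^ 'd \<Rightarrow> real) \<Rightarrow> real ^ 'd \<Rightarrow> real" where
  "eigfun c k l Y x =
     (let d = CARD('d); nu = nu_l d c l; r = norm x in
       r powr (1 - real d / 2) * bessel_J nu (bessel_zero nu k * r) * Y ((1 / r) *\<^sub>R x))"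

text \<open>Sup norm of f on S (for the continuous functions here this is the L^infinity norm);
  0 is inserted so that the norm of anything on the empty set is 0.\<close>
definition sup_norm_on :: "'a set \<Rightarrow> ('a \<Rightarrow> real) \<Rightarrow> real" where
  "sup_norm_on S f = Sup (insert 0 ((\<lambda>x. \<bar>f x\<bar>) ` S))"

definition D_set :: "real \<Rightarrow> real \<Rightarrow> (real ^ 'd) set" where
  "D_set r eps = {x. \<bar>norm x - r\<bar> \<ge> eps}"

end

theory Submission
  imports Defs "HOL-Real_Asymp.Real_Asymp"
begin

text \<open>
  The factor \<open>Y\<close> cancels from the quotient, so only the radial part matters.  With
  \<open>f t = bessel_J nu (nu * exp t)\<close> Bessel's equation reads \<open>f'' = - nu\<^sup>2 * (exp (2 * t) - 1) * f\<close>, with a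
  turning point at \<open>t = 0\<close>.  For \<open>t < 0\<close> the energy \<open>f'\<^sup>2 + nu\<^sup>2 * q * f\<^sup>2\<close>, \<open>q = exp (2 * t) - 1\<close>, increases
  from \<open>0\<close>, so \<open>f' / f \<ge> nu * sqrt (- q)\<close> and \<open>f\<close> is exponentially small to the left of the turning point.
  For \<open>t > 0\<close> the Sonin function \<open>f\<^sup>2 + f'\<^sup>2 / (nu\<^sup>2 * q)\<close> decreases, and up to a bounded factor it decays
  like \<open>q powr (-1/2)\<close>.  As \<open>f\<close> has a critical point arbitrarily close to \<open>0\<close> once \<open>nu\<close> is large, the maximum of
  \<open>\<bar>f\<bar>\<close> lies near \<open>t = 0\<close> and dominates \<open>\<bar>f\<bar>\<close> on \<open>t \<ge> \<delta>\<close> by an arbitrarily large factor.  No Airy asymptotics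
  are needed.  Finally, Sturm comparison with trigonometric functions on a fixed partition shows that the number of zeros
  of \<open>f\<close> in \<open>{0<..T}\<close> is asymptotic to \<open>nu / pi\<close> times the integral of \<open>sqrt q\<close>, which puts the turning point at
  radius \<open>nu / j \<longlonglongrightarrow> 1 / h w\<close>.
\<close>

section \<open>Bessel functions in the logarithmic variable\<close>

definition bessel_coeff :: "real \<Rightarrow> nat \<Rightarrow> real" where
  "bessel_coeff nu m = (-1) ^ m / (fact m * Gamma (real m + nu + 1))"

text \<open>The functional equation of \<open>Gamma\<close> gives this recurrence, the source of
  both the decay of the coefficients and the differential equation.\<close>

lemma bessel_coeff_Suc:
  assumes "nu > 0"
  shows "(real m + 1) * (real m + 1 + nu) * bessel_coeff nu (Suc m) = - bessel_coeff nu m"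
proof -
  have "real m + nu + 1 > 0" using assms by simp
  then have nz: "real m + nu + 1 \<notin> \<int>\<^sub>\<le>\<^sub>0" by (auto elim!: nonpos_Ints_cases)
  have "Gamma (real (Suc m) + nu + 1) = (real m + nu + 1) * Gamma (real m + nu + 1)"
    using Gamma_plus1[OF nz] by (simp add: algebra_simps)
  moreover have "Gamma (real m + nu + 1) > 0" using \<open>real m + nu + 1 > 0\<close> by (rule Gamma_real_pos)
  moreover have "(fact (Suc m) :: real) = (real m + 1) * fact m" by simp
  ultimately show ?thesis
    using \<open>real m + nu + 1 > 0\<close> unfolding bessel_coeff_def by (simp add: divide_simps del: fact_Suc)
qed

text \<open>Each step of the recurrence divides by \<open>(m + 1) * (m + 1 + nu)\<close>, whose
  second factor exceeds 1. So an exponential series dominates, and the power series converges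
  everywhere.\<close>

lemma abs_bessel_coeff_le:
  assumes "nu > 0"
  shows "\<bar>bessel_coeff nu m\<bar> \<le> \<bar>bessel_coeff nu 0\<bar> / fact m"
proof (induction m)
  case (Suc m)
  have pos: "(real m + 1) * (real m + 1 + nu) > 0" using assms by simp
  have "\<bar>bessel_coeff nu (Suc m)\<bar> * ((real m + 1) * (real m + 1 + nu)) = \<bar>bessel_coeff nu m\<bar>"
    using bessel_coeff_Suc[OF assms, of m] pos
    by (metis abs_minus_cancel abs_mult abs_of_pos mult.commute)
  moreover have "\<bar>bessel_coeff nu (Suc m)\<bar> * (real m + 1) \<le> \<bar>bessel_coeff nu (Suc m)\<bar> * ((real m + 1) * (real m + 1 + nu))"
    using assms by (intro mult_left_mono) auto
  ultimately have "\<bar>bessel_coeff nu (Suc m)\<bar> * (real m + 1) \<le> \<bar>bessel_coeff nu 0\<bar> / fact m"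
    using Suc.IH by linarith
  then have "\<bar>bessel_coeff nu (Suc m)\<bar> \<le> \<bar>bessel_coeff nu 0\<bar> / fact m / (real m + 1)"
    by (subst pos_le_divide_eq) auto
  then show ?case by (simp add: mult.commute add.commute)
qed simp

lemma summable_bessel_coeff:
  assumes "nu > 0"
  shows "summable (\<lambda>m. bessel_coeff nu m * z ^ m)"
proof (rule summable_comparison_test')
  show "summable (\<lambda>m. \<bar>bessel_coeff nu 0\<bar> * (inverse (fact m) * \<bar>z\<bar> ^ m))"
    by (intro summable_mult summable_exp)
  show "norm (bessel_coeff nu m * z ^ m) \<le> \<bar>bessel_coeff nu 0\<bar> * (inverse (fact m) * \<bar>z\<bar> ^ m)" 
    if "m \<ge> 0" for m
    using mult_right_mono[OF abs_bessel_coeff_le[OF assms, of m], of "\<bar>z\<bar> ^ m"]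
    by (simp add: abs_mult power_abs field_simps)
qed

text \<open>The entire function left after splitting off \<open>(x / 2) powr nu\<close> and taking
  \<open>(x / 2)^2\<close> as variable; the primed versions are its termwise derivatives.\<close>

definition bessel_series :: "real \<Rightarrow> real \<Rightarrow> real" where
  "bessel_series nu z = (\<Sum>m. bessel_coeff nu m * z ^ m)"

definition bessel_series' :: "real \<Rightarrow> real \<Rightarrow> real" where
  "bessel_series' nu z = (\<Sum>m. diffs (bessel_coeff nu) m * z ^ m)"

definition bessel_series'' :: "real \<Rightarrow> real \<Rightarrow> real" where
  "bessel_series'' nu z = (\<Sum>m. diffs (diffs (bessel_coeff nu)) m * z ^ m)"

lemma DERIV_bessel_series:
  assumes "nu > 0"
  shows "(bessel_series nu has_real_derivative bessel_series' nu z) (at z)"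
  unfolding bessel_series_def bessel_series'_def
  by (rule termdiffs_strong_converges_everywhere) (rule summable_bessel_coeff[OF assms])

lemma summable_diffs_bessel_coeff:
  assumes "nu > 0"
  shows "summable (\<lambda>m. diffs (bessel_coeff nu) m * z ^ m)"
  by (rule termdiff_converges_all) (rule summable_bessel_coeff[OF assms])

lemma DERIV_bessel_series':
  assumes "nu > 0"
  shows "(bessel_series' nu has_real_derivative bessel_series'' nu z) (at z)"
  unfolding bessel_series'_def bessel_series''_def
  by (rule termdiffs_strong_converges_everywhere) (rule summable_diffs_bessel_coeff[OF assms])

text \<open>With \<open>c\<close> for the coefficients, the coefficient of \<open>z ^ m\<close> on
  the left is \<open>(m + 1) * (m + 1 + nu) * c (m + 1) + c m\<close>, which the recurrence makes
  zero.\<close>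

lemma bessel_series_ode:
  assumes "nu > 0"
  shows "z * bessel_series'' nu z + (nu + 1) * bessel_series' nu z + bessel_series nu z = 0"
proof -
  let ?c = "bessel_coeff nu"
  have s2: "(\<lambda>m. diffs (diffs ?c) m * z ^ m) sums bessel_series'' nu z"
    unfolding bessel_series''_def
    by (rule summable_sums, rule termdiff_converges_all) (rule summable_diffs_bessel_coeff[OF assms])
  have "(\<lambda>m. z * (diffs (diffs ?c) m * z ^ m)) sums (z * bessel_series'' nu z)"
    by (rule sums_mult[OF s2])
  then have "(\<lambda>m. real (Suc m) * diffs ?c (Suc m) * z ^ Suc m) sums (z * bessel_series'' nu z)"
    by (rule sums_cong[THEN iffD1, rotated]) (simp add: diffs_def algebra_simps)
  \<comment> \<open>The index shift costs nothing because the factor \<open>real m\<close> kills the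
    term at 0.\<close>
  then have "(\<lambda>m. real m * diffs ?c m * z ^ m) sums (z * bessel_series'' nu z)"
    by (subst (asm) sums_Suc_iff[of "\<lambda>m. real m * diffs ?c m * z ^ m"]) simp
  moreover have "(\<lambda>m. diffs ?c m * z ^ m) sums bessel_series' nu z"
    unfolding bessel_series'_def by (rule summable_sums[OF summable_diffs_bessel_coeff[OF assms]])
  moreover have "(\<lambda>m. ?c m * z ^ m) sums bessel_series nu z"
    unfolding bessel_series_def by (rule summable_sums[OF summable_bessel_coeff[OF assms]])
  ultimately have "(\<lambda>m. real m * diffs ?c m * z ^ m + (nu + 1) * (diffs ?c m * z ^ m) + ?c m * z ^ m) sums
     (z * bessel_series'' nu z + (nu + 1) * bessel_series' nu z + bessel_series nu z)"
    by (intro sums_add sums_mult)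
  moreover have "real m * diffs ?c m * z ^ m + (nu + 1) * (diffs ?c m * z ^ m) + ?c m * z ^ m = 0" for m
  proof -
    have "real m * diffs ?c m * z ^ m + (nu + 1) * (diffs ?c m * z ^ m) + ?c m * z ^ m
      = ((real m + 1) * (real m + 1 + nu) * ?c (Suc m) + ?c m) * z ^ m"
      by (simp add: diffs_def algebra_simps)
    then show ?thesis by (simp add: bessel_coeff_Suc[OF assms])
  qed
  ultimately have "(\<lambda>m. 0) sums (z * bessel_series'' nu z + (nu + 1) * bessel_series' nu z + bessel_series nu z)"
    by simp
  then show ?thesis using sums_unique2 sums_zero by blast
qed

lemma bessel_J_eq_series:
  assumes "nu > 0"
  shows "bessel_J nu x = (x / 2) powr nu * bessel_series nu ((x / 2)\<^sup>2)"
proof -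
  have "bessel_J nu x = (\<Sum>m. (x / 2) powr nu * (bessel_coeff nu m * ((x / 2)\<^sup>2) ^ m))"
    unfolding bessel_J_def bessel_coeff_def by (intro suminf_cong) (simp add: power_mult)
  also have "\<dots> = (x / 2) powr nu * bessel_series nu ((x / 2)\<^sup>2)"
    unfolding bessel_series_def by (rule suminf_mult[OF summable_bessel_coeff[OF assms]])
  finally show ?thesis .
qed

text \<open>The variable is \<open>t = ln (x / nu)\<close>, which turns Bessel's equation into one without a first-order term.\<close>

locale bessel_profile =
  fixes nu :: real and f f1 :: "real \<Rightarrow> real"
  assumes nu_pos: "nu > 0"
    and DERIV_f: "(f has_real_derivative f1 t) (at t)"
    and DERIV_f1: "(f1 has_real_derivative - (nu\<^sup>2 * (exp (2 * t) - 1) * f t)) (at t)"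
    and f_tendsto: "(f \<longlongrightarrow> 0) at_bot"
    and f1_tendsto: "(f1 \<longlongrightarrow> 0) at_bot"
    and f_pos_at_bot: "eventually (\<lambda>t. f t > 0) at_bot"
    and f1_pos_at_bot: "eventually (\<lambda>t. f1 t > 0) at_bot"

text \<open>With \<open>z t = nu^2 / 4 * exp (2 * t)\<close> the profile is
  \<open>C * exp (nu * t) * A (z t)\<close> and its derivative
  \<open>C * exp (nu * t) * B t\<close>. As \<open>t\<close> tends to minus infinity,
  \<open>z t\<close> tends to 0 and \<open>A (z t)\<close> and \<open>B t\<close> tend to positive
  constants, which settles the limits and signs.\<close>

lemma bessel_profile_bessel_J:
  assumes "nu > 0"
  obtains f1 where "bessel_profile nu (\<lambda>t. bessel_J nu (nu * exp t)) f1"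
proof
  define C where "C = (nu / 2) powr nu"
  define z where "z = (\<lambda>t::real. nu\<^sup>2 / 4 * exp (2 * t))"
  define A where "A = bessel_series nu"
  define A' where "A' = bessel_series' nu"
  define A'' where "A'' = bessel_series'' nu"
  define B where "B = (\<lambda>t. nu * A (z t) + 2 * z t * A' (z t))"
  have C: "C > 0" using assms by (simp add: C_def)
  have f: "bessel_J nu (nu * exp t) = C * exp (nu * t) * A (z t)" for t
  proof -
    have "(nu * exp t / 2) powr nu = (nu / 2) powr nu * exp t powr nu"
      using assms by (subst powr_mult [symmetric]) auto
    then have "(nu * exp t / 2) powr nu = C * exp (nu * t)" by (simp add: C_def powr_def)
    moreover have "(nu * exp t / 2)\<^sup>2 = z t"
      by (simp add: z_def power_mult_distrib power_divide exp_double)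
    ultimately show ?thesis unfolding bessel_J_eq_series[OF assms] A_def by simp
  qed
  have dz: "(z has_real_derivative 2 * z t) (at t)" for t
    unfolding z_def by (auto intro!: derivative_eq_intros)
  have dA: "(A has_real_derivative A' u) (at u)" for u
    unfolding A_def A'_def by (rule DERIV_bessel_series[OF assms])
  have dA': "(A' has_real_derivative A'' u) (at u)" for u
    unfolding A'_def A''_def by (rule DERIV_bessel_series'[OF assms])
  have dAz: "((\<lambda>t. A (z t)) has_real_derivative A' (z t) * (2 * z t)) (at t)" for t
    by (rule DERIV_chain2[OF dA dz])
  have dAz': "((\<lambda>t. A' (z t)) has_real_derivative A'' (z t) * (2 * z t)) (at t)" for t
    by (rule DERIV_chain2[OF dA' dz])
  have ode: "z t * A'' (z t) = - (nu + 1) * A' (z t) - A (z t)" for t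
    using bessel_series_ode[OF assms, of "z t"] unfolding A_def A'_def A''_def
    by (simp only: mult_minus_left)
  have z0: "(z \<longlongrightarrow> 0) at_bot" unfolding z_def by real_asymp
  have isA: "isCont A 0" "isCont A' 0" using dA dA' DERIV_isCont by blast+
  have Az0: "((\<lambda>t. A (z t)) \<longlongrightarrow> A 0) at_bot" by (rule isCont_tendsto_compose[OF isA(1) z0])
  have Az0': "((\<lambda>t. A' (z t)) \<longlongrightarrow> A' 0) at_bot" by (rule isCont_tendsto_compose[OF isA(2) z0])
  have B0: "(B \<longlongrightarrow> nu * A 0) at_bot"
    unfolding B_def by (rule tendsto_eq_intros Az0 Az0' z0 refl | simp)+
  have "A 0 = bessel_coeff nu 0" unfolding A_def bessel_series_def by simp
  also have "\<dots> > 0" unfolding bessel_coeff_def using assms by (simp add: Gamma_real_pos)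
  finally have A0: "A 0 > 0" .
  have e0: "((\<lambda>t. C * exp (nu * t)) \<longlongrightarrow> 0) at_bot" using assms by real_asymp
  show "bessel_profile nu (\<lambda>t. bessel_J nu (nu * exp t)) (\<lambda>t. C * exp (nu * t) * B t)"
    unfolding f
  proof
    show "nu > 0" by fact
    show "((\<lambda>t. C * exp (nu * t) * A (z t)) has_real_derivative C * exp (nu * t) * B t) (at t)" for t
      by (rule derivative_eq_intros dAz refl | simp add: B_def algebra_simps)+
    show "((\<lambda>t. C * exp (nu * t) * B t) has_real_derivative
            - (nu\<^sup>2 * (exp (2 * t) - 1) * (C * exp (nu * t) * A (z t)))) (at t)" for t
    proof -
      define X where "X = nu * (A' (z t) * (2 * z t)) + (2 * (2 * z t) * A' (z t) + 2 * z t * (A'' (z t) * (2 * z t)))"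
      have dB: "(B has_real_derivative X) (at t)"
        unfolding B_def X_def by (rule derivative_eq_intros dAz dAz' dz refl | simp add: algebra_simps)+
      have "((\<lambda>t. C * exp (nu * t) * B t) has_real_derivative C * exp (nu * t) * (nu * B t + X)) (at t)"
        by (rule derivative_eq_intros dB refl | simp add: algebra_simps)+
      moreover have "nu * B t + X = - (nu\<^sup>2 * (exp (2 * t) - 1) * A (z t))"
      proof -
        have "nu * B t + X = nu\<^sup>2 * A (z t) + 4 * z t * ((nu + 1) * A' (z t) + z t * A'' (z t))"
          unfolding B_def X_def by (simp add: algebra_simps power2_eq_square)
        also have "\<dots> = nu\<^sup>2 * A (z t) - 4 * z t * A (z t)" unfolding ode by (simp add: algebra_simps)
        also have "4 * z t = nu\<^sup>2 * exp (2 * t)" by (simp add: z_def)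
        finally show ?thesis by (simp add: algebra_simps)
      qed
      ultimately show ?thesis by (elim DERIV_cong) (simp add: ac_simps)
    qed
    show "((\<lambda>t. C * exp (nu * t) * A (z t)) \<longlongrightarrow> 0) at_bot"
      using tendsto_mult[OF e0 Az0] by simp
    show "((\<lambda>t. C * exp (nu * t) * B t) \<longlongrightarrow> 0) at_bot"
      using tendsto_mult[OF e0 B0] by simp
    have "eventually (\<lambda>t. A (z t) > 0) at_bot" using order_tendstoD(1)[OF Az0 A0] .
    then show "eventually (\<lambda>t. C * exp (nu * t) * A (z t) > 0) at_bot"
      by eventually_elim (use C in simp)
    have "eventually (\<lambda>t. B t > 0) at_bot" using order_tendstoD(1)[OF B0, of 0] A0 assms by simp
    then show "eventually (\<lambda>t. C * exp (nu * t) * B t > 0) at_bot"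
      by eventually_elim (use C in simp)
  qed
qed

section \<open>Energy functionals and decay away from the turning point\<close>

context bessel_profile
begin

lemma continuous_f: "continuous_on S f"
  using DERIV_f DERIV_isCont continuous_at_imp_continuous_on by blast

lemma continuous_f1: "continuous_on S f1"
  using DERIV_f1 DERIV_isCont continuous_at_imp_continuous_on by blast

section \<open>Energy and decay left of the turning point\<close>

definition energy :: "real \<Rightarrow> real" where
  "energy t = (f1 t)\<^sup>2 + nu\<^sup>2 * (exp (2 * t) - 1) * (f t)\<^sup>2"

text \<open>The terms in \<open>f t * f1 t\<close> cancel by the differential equation, so only the
  derivative of the increasing coefficient survives.\<close>

lemma DERIV_energy: "(energy has_real_derivative 2 * nu\<^sup>2 * exp (2 * t) * (f t)\<^sup>2) (at t)"
  unfolding energy_def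
  by (rule derivative_eq_intros DERIV_f DERIV_f1 refl | simp add: algebra_simps power2_eq_square)+

lemma energy_mono: "s \<le> t \<Longrightarrow> energy s \<le> energy t"
  by (rule DERIV_nonneg_imp_nondecreasing) (auto intro!: exI DERIV_energy)

lemma energy_nonneg: "energy t \<ge> 0"
proof -
  have q: "((\<lambda>t::real. exp (2 * t) - 1) \<longlongrightarrow> -1) at_bot" by real_asymp
  have "((\<lambda>t. (f1 t)\<^sup>2 + nu\<^sup>2 * (exp (2 * t) - 1) * (f t)\<^sup>2) \<longlongrightarrow> 0\<^sup>2 + nu\<^sup>2 * (-1) * 0\<^sup>2) at_bot"
    by (intro tendsto_intros f_tendsto f1_tendsto q)
  then have lim: "(energy \<longlongrightarrow> 0) at_bot" by (simp add: energy_def[abs_def])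
  have "eventually (\<lambda>s. energy s \<le> energy t) at_bot"
    using eventually_le_at_bot[of t] by eventually_elim (rule energy_mono)
  then show ?thesis by (rule tendsto_upperbound[OF lim]) simp
qed

text \<open>Up to 0 the product \<open>f * f1\<close> is nondecreasing, its derivative being a sum
  of two nonnegative terms. It is positive somewhere far to the left, so neither factor can vanish
  or change sign afterwards.\<close>

lemma f_f1_pos:
  assumes "t \<le> 0"
  shows "f t > 0" "f1 t > 0"
proof -
  have d: "((\<lambda>t. f t * f1 t) has_real_derivative (f1 s)\<^sup>2 + nu\<^sup>2 * (1 - exp (2 * s)) * (f s)\<^sup>2) (at s)" for s
    by (rule derivative_eq_intros DERIV_f DERIV_f1 refl | simp)+
       (simp add: algebra_simps power2_eq_square)
  have "eventually (\<lambda>s. s \<le> t \<and> f s > 0 \<and> f1 s > 0) at_bot"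
    using eventually_le_at_bot[of t] f_pos_at_bot f1_pos_at_bot by eventually_elim auto
  then obtain s0 where s0: "s0 \<le> t" "f s0 > 0" "f1 s0 > 0"
    using eventually_happens' trivial_limit_at_bot_linorder by blast
  have pos: "f s * f1 s > 0" if s: "s0 \<le> s" "s \<le> t" for s
  proof -
    have "f s0 * f1 s0 \<le> f s * f1 s"
    proof (rule DERIV_nonneg_imp_nondecreasing[OF s(1)])
      fix x assume "s0 \<le> x" "x \<le> s"
      then have "x \<le> 0" using s assms by simp
      then have "(f1 x)\<^sup>2 + nu\<^sup>2 * (1 - exp (2 * x)) * (f x)\<^sup>2 \<ge> 0" by simp
      then show "\<exists>y. ((\<lambda>t. f t * f1 t) has_real_derivative y) (at x) \<and> 0 \<le> y"
        using d by blast
    qed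
    then show ?thesis using s0 by (smt (verit) mult_pos_pos)
  qed
  show "f t > 0"
  proof (rule ccontr)
    assume "\<not> f t > 0"
    then obtain x where "s0 \<le> x" "x \<le> t" "f x = 0"
      using IVT2'[of f t 0 s0] s0 continuous_f by force
    then show False using pos[of x] by simp
  qed
  then show "f1 t > 0" using pos[of t] s0 by (simp add: zero_less_mult_iff)
qed

lemma f_mono_left:
  assumes "s \<le> t" "t \<le> 0"
  shows "f s \<le> f t"
proof (rule DERIV_nonneg_imp_nondecreasing[OF assms(1)])
  show "\<exists>y. (f has_real_derivative y) (at x) \<and> 0 \<le> y" if "s \<le> x" "x \<le> t" for x
    using DERIV_f[of x] f_f1_pos(2)[of x] that assms less_imp_le by fastforce
qed

lemma f1_ge:
  assumes "t \<le> 0"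
  shows "nu * sqrt (1 - exp (2 * t)) * f t \<le> f1 t"
proof -
  have "(nu * sqrt (1 - exp (2 * t)) * f t)\<^sup>2 = nu\<^sup>2 * (1 - exp (2 * t)) * (f t)\<^sup>2"
    using assms by (simp add: power_mult_distrib)
  also have "\<dots> \<le> (f1 t)\<^sup>2" using energy_nonneg[of t] by (simp add: energy_def algebra_simps)
  finally show ?thesis using f_f1_pos(2)[OF assms] power2_le_imp_le less_imp_le by blast
qed

text \<open>The lower bound on \<open>f1\<close>, with \<open>b\<close> evaluated at
  \<open>- \<delta> / 2\<close>, makes \<open>exp (- nu * b * t) * f t\<close> nondecreasing up to
  that point; the remaining stretch of length \<open>\<delta> / 2\<close> provides the decay. The
  weight \<open>exp (- a * t)\<close> will stand for the power of the radius in the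
  eigenfunction.\<close>

lemma left_decay:
  assumes b: "b = sqrt (1 - exp (- \<delta>))" and "\<delta> > 0" and "a \<le> nu * b" and t: "t \<le> - \<delta>"
  shows "exp (- a * t) * f t \<le> exp (a * \<delta> - nu * b * \<delta> / 2) * f 0"
proof -
  define H where "H = (\<lambda>t. exp (- (nu * b) * t) * f t)"
  have dH: "(H has_real_derivative exp (- (nu * b) * s) * (f1 s - nu * b * f s)) (at s)" for s
    unfolding H_def
    by (rule derivative_eq_intros DERIV_f refl | simp)+ (simp add: algebra_simps)
  have "H t \<le> H (- \<delta> / 2)"
  proof (rule DERIV_nonneg_imp_nondecreasing[where f = H])
    show "t \<le> - \<delta> / 2" using t \<open>\<delta> > 0\<close> by simp
    fix s assume s: "t \<le> s" "s \<le> - \<delta> / 2"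
    then have "s \<le> 0" using \<open>\<delta> > 0\<close> by simp
    have "b \<le> sqrt (1 - exp (2 * s))" unfolding b using s by simp
    then have "nu * b * f s \<le> nu * sqrt (1 - exp (2 * s)) * f s"
      using nu_pos f_f1_pos(1)[OF \<open>s \<le> 0\<close>] by (intro mult_right_mono mult_left_mono) auto
    also have "\<dots> \<le> f1 s" using f1_ge[OF \<open>s \<le> 0\<close>] .
    finally have "exp (- (nu * b) * s) * (f1 s - nu * b * f s) \<ge> 0" by simp
    then show "\<exists>y. (H has_real_derivative y) (at s) \<and> 0 \<le> y" using dH by blast
  qed
  \<comment> \<open>This exchanges the weight \<open>nu * b\<close> for \<open>a\<close>. The new
    exponent is nondecreasing in \<open>t\<close> because \<open>a \<le> nu * b\<close>, so
    \<open>t\<close> can then be replaced by \<open>- \<delta>\<close>.\<close>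
  then have "exp (nu * b * t - a * t) * H t \<le> exp (nu * b * t - a * t) * H (- \<delta> / 2)"
    by (intro mult_left_mono) auto
  also have "exp (nu * b * t - a * t) * H t = exp (- a * t) * f t"
    unfolding H_def by (simp add: mult_exp_exp)
  also have "exp (nu * b * t - a * t) * H (- \<delta> / 2) \<le> exp (a * \<delta> - nu * b * \<delta>) * H (- \<delta> / 2)"
  proof (intro mult_right_mono)
    have "(nu * b - a) * t \<le> (nu * b - a) * (- \<delta>)" using assms by (intro mult_left_mono) auto
    then show "exp (nu * b * t - a * t) \<le> exp (a * \<delta> - nu * b * \<delta>)" by (simp add: algebra_simps)
    show "0 \<le> H (- \<delta> / 2)" unfolding H_def using f_f1_pos(1)[of "-\<delta>/2"] \<open>\<delta> > 0\<close> by simp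
  qed
  also have "\<dots> = exp (a * \<delta> - nu * b * \<delta> / 2) * f (- \<delta> / 2)"
    unfolding H_def by (simp add: mult_exp_exp)
  also have "\<dots> \<le> exp (a * \<delta> - nu * b * \<delta> / 2) * f 0"
    using f_mono_left[of "-\<delta>/2" 0] \<open>\<delta> > 0\<close> by simp
  finally show ?thesis .
qed

section \<open>Sonin function and decay right of the turning point\<close>

definition sonin :: "real \<Rightarrow> real" where
  "sonin t = (f t)\<^sup>2 + (f1 t)\<^sup>2 / (nu\<^sup>2 * (exp (2 * t) - 1))"

lemma sonin_ge: "t > 0 \<Longrightarrow> (f t)\<^sup>2 \<le> sonin t"
  by (simp add: sonin_def)

text \<open>Write the second summand as \<open>f1^2 * R\<close>. Since
  \<open>nu^2 * (exp (2 * t) - 1) * R = 1\<close>, the mixed terms cancel and what remains is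
  \<open>f1^2\<close> times the derivative of the decreasing function \<open>R\<close>.\<close>

lemma sonin_antimono:
  assumes "0 < s" "s \<le> t"
  shows "sonin t \<le> sonin s"
proof (rule DERIV_nonpos_imp_nonincreasing[OF assms(2)])
  fix x assume x: "s \<le> x" "x \<le> t"
  then have q: "exp (2 * x) - 1 > 0" using assms by simp
  define R where "R = (\<lambda>t. 1 / (nu\<^sup>2 * (exp (2 * t) - 1)))"
  have R: "nu\<^sup>2 * (exp (2 * x) - 1) * R x = 1" unfolding R_def using q nu_pos by simp
  have "(R has_real_derivative - (nu\<^sup>2 * (2 * exp (2 * x))) / (nu\<^sup>2 * (exp (2 * x) - 1))\<^sup>2) (at x)"
    unfolding R_def using q nu_pos by (auto intro!: derivative_eq_intros simp: power2_eq_square)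
  then have dR: "(R has_real_derivative - (2 * nu\<^sup>2 * exp (2 * x) * (R x)\<^sup>2)) (at x)"
    by (elim DERIV_cong) (simp add: R_def power_divide)
  have "((\<lambda>t. (f t)\<^sup>2 + (f1 t)\<^sup>2 * R t) has_real_derivative
     2 * f x * f1 x + (2 * f1 x * (- (nu\<^sup>2 * (exp (2 * x) - 1) * f x)) * R x + (f1 x)\<^sup>2 * (- (2 * nu\<^sup>2 * exp (2 * x) * (R x)\<^sup>2)))) (at x)"
    by (rule derivative_eq_intros DERIV_f DERIV_f1 dR refl | simp)+
  moreover have "2 * f x * f1 x + (2 * f1 x * (- (nu\<^sup>2 * (exp (2 * x) - 1) * f x)) * R x + (f1 x)\<^sup>2 * (- (2 * nu\<^sup>2 * exp (2 * x) * (R x)\<^sup>2)))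
     = 2 * f x * f1 x * (1 - nu\<^sup>2 * (exp (2 * x) - 1) * R x) - 2 * nu\<^sup>2 * exp (2 * x) * (f1 x * R x)\<^sup>2"
    by (simp add: algebra_simps power_mult_distrib)
  moreover have "sonin = (\<lambda>t. (f t)\<^sup>2 + (f1 t)\<^sup>2 * R t)"
    by (simp add: sonin_def R_def fun_eq_iff)
  ultimately have "(sonin has_real_derivative - (2 * nu\<^sup>2 * exp (2 * x) * (f1 x * R x)\<^sup>2)) (at x)"
    using R by simp
  moreover have "- (2 * nu\<^sup>2 * exp (2 * x) * (f1 x * R x)\<^sup>2) \<le> 0" by simp
  ultimately show "\<exists>y. (sonin has_real_derivative y) (at x) \<and> y \<le> 0" by blast
qed

text \<open>Otherwise \<open>f1\<close> would stay positive on \<open>{0..a}\<close>, so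
  \<open>f\<close> would be increasing and concave there. Concavity on the first half gives
  \<open>f1 (a / 2) < 2 / a * f (a / 2)\<close>, while on the second half \<open>f1\<close> falls by
  at least \<open>a / 2 * nu^2 * (exp a - 1) * f (a / 2)\<close>. Under \<open>large\<close> this
  contradicts \<open>f1 a > 0\<close>.\<close>

lemma critical_point:
  assumes "a > 0" and large: "nu\<^sup>2 * (exp a - 1) * a\<^sup>2 > 4"
  obtains t where "0 < t" "t \<le> a" "f1 t = 0"
proof -
  have "\<exists>t. 0 < t \<and> t \<le> a \<and> f1 t = 0"
  proof (rule ccontr)
    assume no: "\<not> ?thesis"
    have f1p: "f1 t > 0" if "0 \<le> t" "t \<le> a" for t
    proof (rule ccontr)
      assume "\<not> f1 t > 0"
      then have "\<exists>x\<ge>0. x \<le> t \<and> f1 x = 0"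
        using f_f1_pos(2)[of 0] continuous_f1 that(1) by (intro IVT2') auto
      then obtain x where x: "0 \<le> x" "x \<le> t" "f1 x = 0" by blast
      moreover have "x \<noteq> 0" using f_f1_pos(2)[of 0] x(3) by auto
      ultimately have "0 < x \<and> x \<le> a \<and> f1 x = 0" using that(2) by linarith
      then show False using no by blast
    qed
    have fm: "f s \<le> f t" if "0 \<le> s" "s \<le> t" "t \<le> a" for s t
    proof (rule DERIV_nonneg_imp_nondecreasing[OF that(2)])
      fix x assume "s \<le> x" "x \<le> t"
      then have "0 \<le> f1 x" using f1p[of x] that by simp
      then show "\<exists>y. (f has_real_derivative y) (at x) \<and> 0 \<le> y" using DERIV_f by blast
    qed
    have f0: "f t > 0" if "0 \<le> t" "t \<le> a" for t
      using fm[of 0 t] f_f1_pos(1)[of 0] that by simp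
    have f1m: "f1 t \<le> f1 s" if "0 \<le> s" "s \<le> t" "t \<le> a" for s t
    proof (rule DERIV_nonpos_imp_nonincreasing[OF that(2)])
      fix x assume x: "s \<le> x" "x \<le> t"
      have "- (nu\<^sup>2 * (exp (2 * x) - 1) * f x) \<le> 0" using f0[of x] x that by simp
      then show "\<exists>y. (f1 has_real_derivative y) (at x) \<and> y \<le> 0"
        using DERIV_f1 by blast
    qed
    obtain x where x: "0 < x" "x < a / 2" "f (a / 2) - f 0 = (a / 2 - 0) * f1 x"
      using MVT2[of 0 "a/2" f f1, OF _ DERIV_f] \<open>a > 0\<close> by auto
    have "a / 2 * f1 (a / 2) \<le> a / 2 * f1 x" using f1m[of x "a/2"] x \<open>a > 0\<close> by simp
    then have 1: "a / 2 * f1 (a / 2) < f (a / 2)"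
      using x(3) f_f1_pos(1)[of 0, OF order_refl] unfolding diff_0_right by linarith
    obtain y where y: "a / 2 < y" "y < a" "f1 a - f1 (a / 2) = (a - a / 2) * (- (nu\<^sup>2 * (exp (2 * y) - 1) * f y))"
      using MVT2[of "a/2" a f1 "\<lambda>y. - (nu\<^sup>2 * (exp (2 * y) - 1) * f y)", OF _ DERIV_f1] \<open>a > 0\<close> by auto
    have "nu\<^sup>2 * (exp a - 1) * f (a / 2) \<le> nu\<^sup>2 * (exp (2 * y) - 1) * f y"
      using y \<open>a > 0\<close> f0[of "a/2"] fm[of "a/2" y] by (intro mult_mono) auto
    then have "a / 2 * (nu\<^sup>2 * (exp a - 1) * f (a / 2)) \<le> a / 2 * (nu\<^sup>2 * (exp (2 * y) - 1) * f y)"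
      using \<open>a > 0\<close> by simp
    also have "\<dots> \<le> f1 (a / 2)" using y f1p[of a] \<open>a > 0\<close> by simp
    finally have "a / 2 * (a / 2 * (nu\<^sup>2 * (exp a - 1) * f (a / 2))) \<le> a / 2 * f1 (a / 2)"
      using \<open>a > 0\<close> by (intro mult_left_mono) auto
    then have "(nu\<^sup>2 * (exp a - 1) * a\<^sup>2) * f (a / 2) < 4 * f (a / 2)"
      using 1 by (simp add: power2_eq_square algebra_simps)
    then show False using large f0[of "a/2"] \<open>a > 0\<close> by simp
  qed
  then show ?thesis using that by (elim exE conjE)
qed

text \<open>
  With \<open>G = s * f\<^sup>2 + f'\<^sup>2 / (nu\<^sup>2 * s)\<close> the oscillating terms of \<open>G'\<close> are a multiple of \<open>(f * f')'\<close>.  Adding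
  \<open>p * f * f' / nu\<^sup>2\<close> with \<open>p = 1 / s + 1 / s ^ 3\<close> removes them and leaves \<open>p' * f * f' / nu\<^sup>2\<close>, which is \<open>O(1 / nu)\<close>
  relative to \<open>G\<close>.
\<close>

lemma wkb_decay:
  assumes "a > 0" and s: "s = (\<lambda>t. sqrt (exp (2 * t) - 1))"
    and p_le: "1 / s a + 1 / s a ^ 3 \<le> nu" and "a \<le> b"
  shows "s b * sonin b \<le> 3 * exp 1 * (s a * sonin a)"
proof -
  define p where "p = (\<lambda>t. 1 / s t + 1 / s t ^ 3)"
  define p' where "p' = (\<lambda>t. - (1 / s t ^ 2 + 3 / s t ^ 4) * (exp (2 * t) / s t))"
  define G where "G = (\<lambda>t. s t * (f t)\<^sup>2 + (f1 t)\<^sup>2 / (nu\<^sup>2 * s t))"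
  define K where "K = (\<lambda>t. G t + p t * f t * f1 t / nu\<^sup>2)"
  \<comment> \<open>The factor \<open>exp (p / nu)\<close> absorbs the remainder
    \<open>p' * f * f1 / nu^2\<close> in the derivative of \<open>K\<close>: its own contribution
    \<open>p' * K / nu\<close> is nonpositive and at least as large in modulus.\<close>
  define L where "L = (\<lambda>t. K t * exp (p t / nu))"
  have sp: "s t > 0" and s2: "exp (2 * t) = s t ^ 2 + 1" if "t \<ge> a" for t
    unfolding s using that \<open>a > 0\<close> by simp_all
  have G_eq: "G t = s t * sonin t" if "t \<ge> a" for t
    unfolding G_def sonin_def using sp[OF that] s2[OF that] nu_pos
    by (simp add: field_simps power2_eq_square)
  have ds: "(s has_real_derivative exp (2 * t) / s t) (at t)" if "t \<ge> a" for t
    using sp[OF that] unfolding s by (auto intro!: derivative_eq_intros simp: field_simps)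
  have dp: "(p has_real_derivative p' t) (at t)" if "t \<ge> a" for t
    unfolding p_def p'_def using sp[OF that]
    by (auto intro!: derivative_eq_intros ds[OF that] simp: field_simps eval_nat_numeral)
  have p'_le: "p' t \<le> 0" if "t \<ge> a" for t
  proof -
    have "0 \<le> (1 / s t ^ 2 + 3 / s t ^ 4) * (exp (2 * t) / s t)"
      using sp[OF that] by (intro mult_nonneg_nonneg add_nonneg_nonneg) auto
    then show ?thesis unfolding p'_def by (simp only: mult_minus_left neg_le_0_iff_le)
  qed
  have p_pos: "p t > 0" if "t \<ge> a" for t unfolding p_def using sp[OF that] by (simp add: add_pos_pos)
  have p_mono: "p t \<le> p a" if "t \<ge> a" for t
  proof (rule DERIV_nonpos_imp_nonincreasing[OF that, where f = p])
    show "\<exists>y. (p has_real_derivative y) (at x) \<and> y \<le> 0" if "a \<le> x" "x \<le> t" for x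
      using dp[OF that(1)] p'_le[OF that(1)] by blast
  qed
  have dK: "(K has_real_derivative p' t * f t * f1 t / nu\<^sup>2) (at t)" if "t \<ge> a" for t
  proof -
    define e where "e = exp (2 * t) / s t"
    define u where "u = 1 / s t"
    have su: "s t * u = 1" and e: "e = s t + u" and pu: "p t = u + u ^ 3"
      unfolding u_def e_def p_def s2[OF that] using sp[OF that]
      by (simp_all add: field_simps power2_eq_square)
    have du: "((\<lambda>t. 1 / s t) has_real_derivative - e * u\<^sup>2) (at t)"
      using sp[OF that] unfolding u_def e_def
      by (auto intro!: derivative_eq_intros ds[OF that] simp: field_simps power2_eq_square)
    define U where "U = (\<lambda>t. 1 / s t)"
    have dU: "(U has_real_derivative - e * u\<^sup>2) (at t)" and Ut: "U t = u"
      using du by (simp_all add: U_def u_def)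
    define N where "N = 1 / nu\<^sup>2"
    have K_eq: "K = (\<lambda>t. s t * (f t)\<^sup>2 + (f1 t)\<^sup>2 * U t * N + p t * (f t * f1 t) * N)"
      unfolding K_def G_def U_def N_def by (simp add: fun_eq_iff mult.commute mult.assoc)
    have ds': "(s has_real_derivative e) (at t)" using ds[OF that] by (simp add: e_def)
    have "(K has_real_derivative
        (e * (f t)\<^sup>2 + s t * (2 * f t * f1 t))
        + (2 * f1 t * (- (nu\<^sup>2 * (exp (2 * t) - 1) * f t)) * U t + (f1 t)\<^sup>2 * (- e * u\<^sup>2)) * N
        + (p' t * (f t * f1 t) + p t * (f1 t * f1 t + f t * (- (nu\<^sup>2 * (exp (2 * t) - 1) * f t)))) * N) (at t)"
      unfolding K_eq
      by (rule derivative_eq_intros ds' dU dp[OF that] DERIV_f DERIV_f1 refl)+ (simp add: algebra_simps)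
    then have D: "(K has_real_derivative
        (e * (f t)\<^sup>2 + s t * (2 * f t * f1 t))
        + (2 * f1 t * (- (nu\<^sup>2 * (exp (2 * t) - 1) * f t)) * u + (f1 t)\<^sup>2 * (- e * u\<^sup>2)) / nu\<^sup>2
        + (p' t * (f t * f1 t) + p t * (f1 t * f1 t + f t * (- (nu\<^sup>2 * (exp (2 * t) - 1) * f t)))) / nu\<^sup>2) (at t)"
      unfolding N_def Ut by simp
    show ?thesis
    proof (rule DERIV_cong[OF D])
      have q: "exp (2 * t) - 1 = (s t)\<^sup>2" using s2[OF that] by simp
      have 1: "(2 * f1 t * (- (nu\<^sup>2 * (exp (2 * t) - 1) * f t)) * u + (f1 t)\<^sup>2 * (- e * u\<^sup>2)) / nu\<^sup>2
         = - (2 * s t * f1 t * f t * (s t * u)) - (f1 t)\<^sup>2 * e * u\<^sup>2 / nu\<^sup>2"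
        unfolding q using nu_pos by (simp add: field_simps power2_eq_square)
      have 2: "(p' t * (f t * f1 t) + p t * (f1 t * f1 t + f t * (- (nu\<^sup>2 * (exp (2 * t) - 1) * f t)))) / nu\<^sup>2
         = p' t * f t * f1 t / nu\<^sup>2 + p t * (f1 t)\<^sup>2 / nu\<^sup>2 - (p t * (s t)\<^sup>2) * (f t)\<^sup>2"
        unfolding q using nu_pos by (simp add: field_simps power2_eq_square)
      \<comment> \<open>The two identities for which \<open>p\<close> is chosen: the first removes
        the terms in \<open>f^2\<close>, the second those in \<open>f1^2\<close>.\<close>
      have 3: "p t * (s t)\<^sup>2 = e" and 4: "e * u\<^sup>2 = p t"
        unfolding pu e using su by algebra+
      have 5: "(f1 t)\<^sup>2 * e * u\<^sup>2 / nu\<^sup>2 = p t * (f1 t)\<^sup>2 / nu\<^sup>2"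
        unfolding 4[symmetric] by (simp add: ac_simps)
      show "(e * (f t)\<^sup>2 + s t * (2 * f t * f1 t))
        + (2 * f1 t * (- (nu\<^sup>2 * (exp (2 * t) - 1) * f t)) * u + (f1 t)\<^sup>2 * (- e * u\<^sup>2)) / nu\<^sup>2
        + (p' t * (f t * f1 t) + p t * (f1 t * f1 t + f t * (- (nu\<^sup>2 * (exp (2 * t) - 1) * f t)))) / nu\<^sup>2
        = p' t * f t * f1 t / nu\<^sup>2"
        unfolding 1 2 3 su 5 by (simp add: algebra_simps)
    qed
  qed
  have ff1: "\<bar>f t * f1 t\<bar> \<le> nu * G t / 2" if "t \<ge> a" for t
  proof -
    \<comment> \<open>The two squares on the right add up to \<open>s * nu^2 * G\<close>.\<close>
    have "2 * (s t * nu * \<bar>f t\<bar>) * \<bar>f1 t\<bar> \<le> (s t * nu * \<bar>f t\<bar>)\<^sup>2 + \<bar>f1 t\<bar>\<^sup>2"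
      by (rule sum_squares_bound)
    then have "2 * s t * nu * \<bar>f t * f1 t\<bar> \<le> s t * nu * (nu * G t)"
    proof -
      have "s t * nu * (nu * G t) = (s t * nu * \<bar>f t\<bar>)\<^sup>2 + \<bar>f1 t\<bar>\<^sup>2"
        unfolding G_def using sp[OF that] nu_pos
        by (simp add: power_mult_distrib distrib_left power2_eq_square)
      moreover have "2 * (s t * nu * \<bar>f t\<bar>) * \<bar>f1 t\<bar> = 2 * s t * nu * \<bar>f t * f1 t\<bar>"
        by (simp add: abs_mult)
      ultimately show ?thesis using \<open>2 * (s t * nu * \<bar>f t\<bar>) * \<bar>f1 t\<bar> \<le> _\<close> by linarith
    qed
    then have "(s t * nu) * (2 * \<bar>f t * f1 t\<bar>) \<le> (s t * nu) * (nu * G t)" by (simp add: algebra_simps)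
    then have "2 * \<bar>f t * f1 t\<bar> \<le> nu * G t"
      using sp[OF that] nu_pos by (subst (asm) mult_le_cancel_left_pos) auto
    then show ?thesis by simp
  qed
  have G0: "G t \<ge> 0" if "t \<ge> a" for t unfolding G_def using sp[OF that] by simp
  \<comment> \<open>By \<open>p_le\<close> and monotonicity \<open>p t \<le> nu\<close>, so
    \<open>K\<close> lies between \<open>G / 2\<close> and \<open>3 / 2 * G\<close>.\<close>
  have KG: "\<bar>K t - G t\<bar> \<le> G t / 2" if "t \<ge> a" for t
  proof -
    have "p t \<le> nu" using p_mono[OF that] p_le by (simp add: p_def)
    have "\<bar>K t - G t\<bar> = p t * \<bar>f t * f1 t\<bar> / nu\<^sup>2"
      unfolding K_def using p_pos[OF that] by (simp add: abs_mult mult.assoc)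
    also have "\<dots> \<le> nu * (nu * G t / 2) / nu\<^sup>2"
      using ff1[OF that] \<open>p t \<le> nu\<close> p_pos[OF that] nu_pos
      by (intro divide_right_mono mult_mono) auto
    also have "\<dots> = G t / 2" using nu_pos by (simp add: power2_eq_square)
    finally show ?thesis .
  qed
  have "L b \<le> L a"
  proof (rule DERIV_nonpos_imp_nonincreasing[OF \<open>a \<le> b\<close>])
    fix t assume "a \<le> t"
    have "(L has_real_derivative (p' t * f t * f1 t / nu\<^sup>2 + p' t * K t / nu) * exp (p t / nu)) (at t)"
      unfolding L_def
      by (rule DERIV_cong[OF DERIV_mult[OF dK[OF \<open>a \<le> t\<close>] DERIV_fun_exp[OF DERIV_cdivide[OF dp[OF \<open>a \<le> t\<close>]]]]])
         (simp add: distrib_right)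
    moreover have "(p' t * f t * f1 t / nu\<^sup>2 + p' t * K t / nu) * exp (p t / nu) \<le> 0"
    proof (rule mult_nonpos_nonneg)
      have "- (f t * f1 t) \<le> nu * K t" 
      proof -
        have "G t / 2 \<le> K t" using KG[OF \<open>a \<le> t\<close>] by linarith
        then have "nu * (G t / 2) \<le> nu * K t" using nu_pos by (intro mult_left_mono) auto
        then show ?thesis using ff1[OF \<open>a \<le> t\<close>] by linarith
      qed
      then have "0 \<le> f t * f1 t / nu\<^sup>2 + K t / nu"
        using nu_pos by (simp add: field_simps power2_eq_square)
      then have "p' t * (f t * f1 t / nu\<^sup>2 + K t / nu) \<le> 0"
        using p'_le[OF \<open>a \<le> t\<close>] by (simp add: mult_nonpos_nonneg)
      then show "p' t * f t * f1 t / nu\<^sup>2 + p' t * K t / nu \<le> 0" by (simp add: algebra_simps)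
    qed simp
    ultimately show "\<exists>y. (L has_real_derivative y) (at t) \<and> y \<le> 0" by blast
  qed
  have Kb: "G b / 2 \<le> K b" using KG[OF \<open>a \<le> b\<close>] by linarith
  then have "K b \<ge> 0" using G0[OF \<open>a \<le> b\<close>] by simp
  have "p b / nu \<ge> 0" using p_pos[OF \<open>a \<le> b\<close>] nu_pos by simp
  then have "K b * 1 \<le> L b" unfolding L_def using \<open>K b \<ge> 0\<close> by (intro mult_left_mono) auto
  also note \<open>L b \<le> L a\<close>
  also have "L a \<le> (3 / 2 * G a) * exp 1"
  proof -
    have "K a \<le> 3 / 2 * G a" using KG[of a] by linarith
    then show ?thesis
      unfolding L_def using G0[of a] p_le nu_pos by (intro mult_mono) (auto simp: p_def)
  qed
  \<comment> \<open>The 3 is the quotient of \<open>3 / 2\<close> and \<open>1 / 2\<close> from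
    comparing \<open>K\<close> with \<open>G\<close>; \<open>exp 1\<close> bounds
    \<open>exp (p a / nu)\<close>.\<close>
  finally have "G b \<le> 3 * exp 1 * G a" using Kb by (simp add: mult.commute mult.left_commute)
  then show ?thesis using G_eq \<open>a \<le> b\<close> by simp
qed

end

section \<open>Zeros of the profile\<close>

context bessel_profile
begin

text \<open>At a zero the energy equals \<open>f1^2\<close>, and it is positive from 0 on.
  Simplicity of the zeros provides the strict inequality in their separation.\<close>

lemma f1_nonzero_at_zero:
  assumes "t \<ge> 0" "f t = 0"
  shows "f1 t \<noteq> 0"
proof -
  have "energy 0 > 0" using f_f1_pos[of 0] by (simp add: energy_def)
  then have "energy t > 0" using energy_mono[OF assms(1)] by simp
  then show ?thesis using assms(2) by (simp add: energy_def)
qed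

text \<open>Comparison with \<open>sin (\<kappa> * (t - \<alpha>))\<close>, whose next zero is
  \<open>\<alpha> + pi / \<kappa>\<close>. If \<open>f\<close> had no zero, the Wronskian
  \<open>W\<close> would be nonincreasing, yet nonpositive at the left end and positive at the right
  end.\<close>

lemma sturm_zero_exists:
  assumes "\<alpha> \<ge> 0" and kappa: "\<kappa> > 0" and q: "\<kappa>\<^sup>2 \<le> nu\<^sup>2 * (exp (2 * \<alpha>) - 1)"
  shows "\<exists>t. \<alpha> < t \<and> t \<le> \<alpha> + pi / \<kappa> \<and> f t = 0"
proof (rule ccontr)
  assume no: "\<not> ?thesis"
  define \<beta> where "\<beta> = \<alpha> + pi / \<kappa>"
  have "\<alpha> < \<beta>" using kappa by (simp add: \<beta>_def)
  have nz: "f t \<noteq> 0" if "\<alpha> < t" "t \<le> \<beta>" for t using no that by (auto simp: \<beta>_def)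
  define \<sigma> where "\<sigma> = sgn (f \<beta>)"
  have sg: "\<sigma> * f t > 0" if "\<alpha> < t" "t \<le> \<beta>" for t
  proof (rule ccontr)
    assume neg: "\<not> \<sigma> * f t > 0"
    have "\<sigma> * f \<beta> > 0" using nz[of \<beta>] \<open>\<alpha> < \<beta>\<close> by (simp add: \<sigma>_def sgn_if)
    then have "\<exists>x\<ge>t. x \<le> \<beta> \<and> \<sigma> * f x = 0"
      using neg that by (intro IVT' continuous_intros continuous_f) auto
    then obtain x where "t \<le> x" "x \<le> \<beta>" "\<sigma> * f x = 0" by blast
    moreover have "\<sigma> \<noteq> 0" using nz[of \<beta>] \<open>\<alpha> < \<beta>\<close> by (simp add: \<sigma>_def sgn_if)
    ultimately show False using nz[of x] that by simp
  qed
  \<comment> \<open>Only the weak sign is available here, since a zero at \<alpha> itself is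
    allowed.\<close>
  have sg\<alpha>: "\<sigma> * f \<alpha> \<ge> 0"
  proof (rule ccontr)
    assume neg: "\<not> \<sigma> * f \<alpha> \<ge> 0"
    then have "\<exists>x\<ge>\<alpha>. x \<le> \<beta> \<and> \<sigma> * f x = 0"
      using sg[of \<beta>] \<open>\<alpha> < \<beta>\<close> by (intro IVT' continuous_intros continuous_f) auto
    then obtain x where "\<alpha> \<le> x" "x \<le> \<beta>" "\<sigma> * f x = 0" by blast
    moreover have "x \<noteq> \<alpha>" using neg \<open>\<sigma> * f x = 0\<close> by auto
    ultimately show False using sg[of x] by (metis less_irrefl order_le_less)
  qed
  define W where "W = (\<lambda>t. \<sigma> * (f1 t * sin (\<kappa> * (t - \<alpha>)) - f t * (\<kappa> * cos (\<kappa> * (t - \<alpha>)))))"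
  have dW: "(W has_real_derivative (\<kappa>\<^sup>2 - nu\<^sup>2 * (exp (2 * t) - 1)) * (\<sigma> * f t) * sin (\<kappa> * (t - \<alpha>))) (at t)" for t
    unfolding W_def
    by (rule derivative_eq_intros DERIV_f DERIV_f1 refl)+ (simp add: algebra_simps power2_eq_square)
  have "W \<beta> \<le> W \<alpha>"
  proof (rule DERIV_nonpos_imp_nonincreasing[where f = W])
    show "\<alpha> \<le> \<beta>" using \<open>\<alpha> < \<beta>\<close> by simp
    fix t assume t: "\<alpha> \<le> t" "t \<le> \<beta>"
    have "\<sigma> * f t \<ge> 0" using sg[of t] sg\<alpha> t by (cases "t = \<alpha>") auto
    moreover have "sin (\<kappa> * (t - \<alpha>)) \<ge> 0"
      using t kappa by (intro sin_ge_zero) (auto simp: \<beta>_def field_simps)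
    moreover have "\<kappa>\<^sup>2 - nu\<^sup>2 * (exp (2 * t) - 1) \<le> 0"
    proof -
      have "nu\<^sup>2 * (exp (2 * \<alpha>) - 1) \<le> nu\<^sup>2 * (exp (2 * t) - 1)" using t by (intro mult_left_mono) auto
      then show ?thesis using q by simp
    qed
    ultimately have "(\<kappa>\<^sup>2 - nu\<^sup>2 * (exp (2 * t) - 1)) * (\<sigma> * f t) * sin (\<kappa> * (t - \<alpha>)) \<le> 0"
      by (intro mult_nonpos_nonneg)
    then show "\<exists>y. (W has_real_derivative y) (at t) \<and> y \<le> 0" using dW by blast
  qed
  moreover have "W \<beta> = \<kappa> * (\<sigma> * f \<beta>)" unfolding W_def \<beta>_def using kappa by simp
  moreover have "W \<alpha> = - (\<kappa> * (\<sigma> * f \<alpha>))" unfolding W_def by simp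
  moreover have "\<kappa> * (\<sigma> * f \<beta>) > 0" using sg[of \<beta>] \<open>\<alpha> < \<beta>\<close> kappa by simp
  moreover have "\<kappa> * (\<sigma> * f \<alpha>) \<ge> 0" using sg\<alpha> kappa by simp
  ultimately show False by linarith
qed

text \<open>
  Picone's identity: for \<open>s = sin (\<kappa> * (t - \<alpha>) + \<eta>)\<close>, positive on \<open>{\<alpha>..\<beta>}\<close>, the function
  \<open>U = f * f' - f\<^sup>2 * s' / s\<close> is nondecreasing and vanishes at every zero of \<open>f\<close>.
\<close>

lemma zeros_separated:
  assumes "0 \<le> \<alpha>" "\<alpha> < \<beta>" and z: "f \<alpha> = 0" "f \<beta> = 0" and kappa: "\<kappa> > 0"
    and q: "nu\<^sup>2 * (exp (2 * \<beta>) - 1) \<le> \<kappa>\<^sup>2"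
  shows "pi / \<kappa> \<le> \<beta> - \<alpha>"
proof (rule ccontr)
  assume "\<not> ?thesis"
  then have short: "\<kappa> * (\<beta> - \<alpha>) < pi" using kappa by (simp add: field_simps)
  \<comment> \<open>Half of the slack: the phase then runs from \<eta> to
    \<open>pi - \<eta>\<close>, so the comparison sine is positive on the closed interval.\<close>
  define \<eta> where "\<eta> = (pi - \<kappa> * (\<beta> - \<alpha>)) / 2"
  have \<eta>: "\<eta> > 0" "\<kappa> * (\<beta> - \<alpha>) + \<eta> < pi" using short by (simp_all add: \<eta>_def field_simps)
  define \<theta> where "\<theta> = (\<lambda>t. \<kappa> * (t - \<alpha>) + \<eta>)"
  have sp: "sin (\<theta> t) > 0" if "\<alpha> \<le> t" "t \<le> \<beta>" for t
  proof (rule sin_gt_zero)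
    show "0 < \<theta> t" using that kappa \<eta> by (simp add: \<theta>_def add_nonneg_pos)
    have "\<kappa> * (t - \<alpha>) \<le> \<kappa> * (\<beta> - \<alpha>)" using that kappa by simp
    then show "\<theta> t < pi" using \<eta> by (simp add: \<theta>_def)
  qed
  define ct where "ct = (\<lambda>t. cos (\<theta> t) / sin (\<theta> t))"
  have d\<theta>: "(\<theta> has_real_derivative \<kappa>) (at t)" for t
    unfolding \<theta>_def by (auto intro!: derivative_eq_intros)
  have dct: "(ct has_real_derivative - \<kappa> * (1 + (ct t)\<^sup>2)) (at t)" if "\<alpha> \<le> t" "t \<le> \<beta>" for t
  proof -
    have D: "(ct has_real_derivative (- sin (\<theta> t) * \<kappa> * sin (\<theta> t) - cos (\<theta> t) * (cos (\<theta> t) * \<kappa>)) / (sin (\<theta> t) * sin (\<theta> t))) (at t)"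
      unfolding ct_def by (rule derivative_eq_intros d\<theta> refl | use sp[OF that] in simp)+
    have eq: "(- S * \<kappa> * S - C * (C * \<kappa>)) / (S * S) = - \<kappa> * (1 + (C / S)\<^sup>2)" if "S \<noteq> 0" for S C
      using that by (simp add: field_simps power2_eq_square)
    have "sin (\<theta> t) \<noteq> 0" using sp[OF that] by simp
    then show ?thesis using DERIV_cong[OF D eq] unfolding ct_def by blast
  qed
  define U where "U = (\<lambda>t. f t * f1 t - \<kappa> * (f t)\<^sup>2 * ct t)"
  have dU: "(U has_real_derivative (f1 t - \<kappa> * f t * ct t)\<^sup>2 + (\<kappa>\<^sup>2 - nu\<^sup>2 * (exp (2 * t) - 1)) * (f t)\<^sup>2) (at t)"
    if "\<alpha> \<le> t" "t \<le> \<beta>" for t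
    unfolding U_def
    by (rule derivative_eq_intros DERIV_f DERIV_f1 dct[OF that] refl)+ (simp add: algebra_simps power2_eq_square)
  have mono: "U s \<le> U \<beta>" if "\<alpha> \<le> s" "s \<le> \<beta>" for s
  proof (rule DERIV_nonneg_imp_nondecreasing[where f = U])
    fix t assume t: "s \<le> t" "t \<le> \<beta>"
    have "nu\<^sup>2 * (exp (2 * t) - 1) \<le> nu\<^sup>2 * (exp (2 * \<beta>) - 1)" using t by (intro mult_left_mono) auto
    then have "0 \<le> (f1 t - \<kappa> * f t * ct t)\<^sup>2 + (\<kappa>\<^sup>2 - nu\<^sup>2 * (exp (2 * t) - 1)) * (f t)\<^sup>2"
      using q by (intro add_nonneg_nonneg mult_nonneg_nonneg) auto
    then show "\<exists>y. (U has_real_derivative y) (at t) \<and> 0 \<le> y"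
      using dU[of t] t that by (meson order_trans)
  qed (use that in simp)
  have U0: "U \<alpha> = 0" "U \<beta> = 0" using z by (simp_all add: U_def)
  \<comment> \<open>Because the zero at \<alpha> is simple, \<open>U\<close> becomes positive just
    to its right, which contradicts monotonicity and \<open>U \<beta> = 0\<close>.\<close>
  have "(U has_real_derivative (f1 \<alpha>)\<^sup>2) (at \<alpha>)" using dU[of \<alpha>] assms(2) z by simp
  moreover have "(f1 \<alpha>)\<^sup>2 > 0" using f1_nonzero_at_zero[OF assms(1) z(1)] by simp
  ultimately obtain d where d: "d > 0" "\<And>h. 0 < h \<Longrightarrow> h < d \<Longrightarrow> U \<alpha> < U (\<alpha> + h)"
    using DERIV_pos_inc_right by blast
  define h where "h = min (d / 2) (\<beta> - \<alpha>)"
  have "0 < h" "h < d" "\<alpha> + h \<le> \<beta>" using d assms(2) by (auto simp: h_def)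
  then show False using d(2)[of h] mono[of "\<alpha> + h"] U0 by simp
qed

text \<open>Half-open, so that adjacent intervals share no zero and counts add up.\<close>

definition zeros :: "real \<Rightarrow> real \<Rightarrow> real set" where
  "zeros \<alpha> \<beta> = {t. \<alpha> < t \<and> t \<le> \<beta> \<and> f t = 0}"

text \<open>The frequency \<kappa> at the right end is the largest on the interval, so zeros are at
  least \<open>pi / \<kappa>\<close> apart and \<open>g\<close>, the index of the cell of that
  width, is injective on them. The extra 1 accounts for cell 0.\<close>

lemma zeros_upper:
  assumes "0 \<le> \<alpha>" "\<alpha> < \<beta>"
  shows "finite (zeros \<alpha> \<beta>)"
    and "real (card (zeros \<alpha> \<beta>)) \<le> (\<beta> - \<alpha>) * nu * sqrt (exp (2 * \<beta>) - 1) / pi + 1"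
proof -
  define \<kappa> where "\<kappa> = nu * sqrt (exp (2 * \<beta>) - 1)"
  have kappa: "\<kappa> > 0" using assms nu_pos by (simp add: \<kappa>_def)
  have q: "nu\<^sup>2 * (exp (2 * \<beta>) - 1) = \<kappa>\<^sup>2" using assms by (simp add: \<kappa>_def power_mult_distrib)
  define g where "g = (\<lambda>t. nat \<lfloor>(t - \<alpha>) * \<kappa> / pi\<rfloor>)"
  have sep: "g s \<noteq> g t" if "s \<in> zeros \<alpha> \<beta>" "t \<in> zeros \<alpha> \<beta>" "s < t" for s t
  proof -
    have st: "\<alpha> < s" "t \<le> \<beta>" "f s = 0" "f t = 0" using that by (auto simp: zeros_def)
    have "nu\<^sup>2 * (exp (2 * t) - 1) \<le> nu\<^sup>2 * (exp (2 * \<beta>) - 1)" using st by (intro mult_left_mono) auto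
    then have "pi / \<kappa> \<le> t - s"
      using zeros_separated[of s t \<kappa>] st that assms kappa q by simp
    then have "1 \<le> (t - s) * \<kappa> / pi" using kappa by (simp add: pos_divide_le_eq)
    moreover have "(t - \<alpha>) * \<kappa> / pi = (s - \<alpha>) * \<kappa> / pi + (t - s) * \<kappa> / pi"
      by (simp add: algebra_simps flip: add_divide_distrib)
    ultimately have "(s - \<alpha>) * \<kappa> / pi + 1 \<le> (t - \<alpha>) * \<kappa> / pi" by simp
    moreover have "0 \<le> (s - \<alpha>) * \<kappa> / pi" using st kappa by simp
    ultimately show ?thesis unfolding g_def by linarith
  qed
  then have inj: "inj_on g (zeros \<alpha> \<beta>)" by (intro linorder_inj_onI) auto
  have sub: "g ` zeros \<alpha> \<beta> \<subseteq> {..nat \<lfloor>(\<beta> - \<alpha>) * \<kappa> / pi\<rfloor>}"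
    unfolding g_def using kappa
    by (auto simp: zeros_def intro!: nat_mono floor_mono divide_right_mono mult_right_mono)
  show fin: "finite (zeros \<alpha> \<beta>)" using inj sub finite_imageD finite_subset finite_atMost by blast
  have "card (zeros \<alpha> \<beta>) \<le> card {..nat \<lfloor>(\<beta> - \<alpha>) * \<kappa> / pi\<rfloor>}"
    using inj sub by (intro card_inj_on_le[of g]) auto
  also have "\<dots> = nat \<lfloor>(\<beta> - \<alpha>) * \<kappa> / pi\<rfloor> + 1" by simp
  finally have "real (card (zeros \<alpha> \<beta>)) \<le> real (nat \<lfloor>(\<beta> - \<alpha>) * \<kappa> / pi\<rfloor>) + 1" by linarith
  moreover have "0 \<le> (\<beta> - \<alpha>) * \<kappa> / pi" using assms kappa by simp
  ultimately have "real (card (zeros \<alpha> \<beta>)) \<le> (\<beta> - \<alpha>) * \<kappa> / pi + 1" by linarith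
  then show "real (card (zeros \<alpha> \<beta>)) \<le> (\<beta> - \<alpha>) * nu * sqrt (exp (2 * \<beta>) - 1) / pi + 1"
    by (simp add: \<kappa>_def mult.assoc)
qed

text \<open>The frequency at the left end is the smallest, so each half-open cell of width
  \<open>pi / \<kappa>\<close> contains a zero; the lost 1 comes from rounding down. At
  \<open>\<alpha> = 0\<close> the frequency is 0 and the bound is just -1.\<close>

lemma zeros_lower:
  assumes "0 \<le> \<alpha>" "\<alpha> < \<beta>"
  shows "(\<beta> - \<alpha>) * nu * sqrt (exp (2 * \<alpha>) - 1) / pi - 1 \<le> real (card (zeros \<alpha> \<beta>))"
proof (cases "\<alpha> = 0")
  case False
  define \<kappa> where "\<kappa> = nu * sqrt (exp (2 * \<alpha>) - 1)"
  have kappa: "\<kappa> > 0" using assms nu_pos False by (simp add: \<kappa>_def)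
  have q: "nu\<^sup>2 * (exp (2 * \<alpha>) - 1) = \<kappa>\<^sup>2" using assms by (simp add: \<kappa>_def power_mult_distrib)
  define m where "m = nat \<lfloor>(\<beta> - \<alpha>) * \<kappa> / pi\<rfloor>"
  have m: "real m \<le> (\<beta> - \<alpha>) * \<kappa> / pi" "(\<beta> - \<alpha>) * \<kappa> / pi - 1 \<le> real m"
  proof -
    have "0 \<le> (\<beta> - \<alpha>) * \<kappa> / pi" using assms kappa by simp
    then show "real m \<le> (\<beta> - \<alpha>) * \<kappa> / pi" "(\<beta> - \<alpha>) * \<kappa> / pi - 1 \<le> real m"
      unfolding m_def by linarith+
  qed
  define x where "x = (\<lambda>i::nat. \<alpha> + real i * (pi / \<kappa>))"
  have "\<exists>t. x i < t \<and> t \<le> x (Suc i) \<and> f t = 0" for i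
  proof -
    have "x i \<ge> \<alpha>" using kappa by (simp add: x_def)
    then have "nu\<^sup>2 * (exp (2 * \<alpha>) - 1) \<le> nu\<^sup>2 * (exp (2 * x i) - 1)" by (intro mult_left_mono) auto
    moreover have "x (Suc i) = x i + pi / \<kappa>" by (simp add: x_def distrib_right add_divide_distrib)
    ultimately show ?thesis using sturm_zero_exists[of "x i" \<kappa>] \<open>x i \<ge> \<alpha>\<close> assms kappa q by simp
  qed
  then obtain t where t: "\<And>i. x i < t i" "\<And>i. t i \<le> x (Suc i)" "\<And>i. f (t i) = 0" by metis
  have xm: "x i \<le> x j" if "i \<le> j" for i j using that kappa by (simp add: x_def divide_right_mono)
  have xm\<beta>: "x m \<le> \<beta>"
    using m(1) kappa by (simp add: x_def field_simps)
  have inj: "inj_on t {..<m}"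
  proof (intro linorder_inj_onI)
    fix i j :: nat assume "i < j"
    then have "t i \<le> x j" using t(2)[of i] xm[of "Suc i" j] by simp
    then show "t i \<noteq> t j" using t(1)[of j] by simp
  qed auto
  have sub: "t ` {..<m} \<subseteq> zeros \<alpha> \<beta>"
  proof
    fix y assume "y \<in> t ` {..<m}"
    then obtain i where i: "i < m" "y = t i" by auto
    have "t i \<le> \<beta>" using t(2)[of i] xm[of "Suc i" m] i xm\<beta> by simp
    moreover have "\<alpha> < t i" using t(1)[of i] xm[of 0 i] by (simp add: x_def)
    ultimately show "y \<in> zeros \<alpha> \<beta>" using i t(3) by (simp add: zeros_def)
  qed
  have "card {..<m} \<le> card (zeros \<alpha> \<beta>)"
    using inj sub zeros_upper(1)[OF assms] by (rule card_inj_on_le)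
  then show ?thesis using m(2) by (simp add: \<kappa>_def mult.assoc)
qed simp

end

section \<open>The WKB phase and the number of zeros\<close>

text \<open>Closed form of the integral of \<open>sqrt (exp (2 * x) - 1)\<close> over
  \<open>{0..t}\<close>; at \<open>t = ln h\<close> it is the left side of the equation that defines
  \<open>h_fun\<close>.\<close>

definition wkb_phase :: "real \<Rightarrow> real" where
  "wkb_phase t = sqrt (exp (2 * t) - 1) - arccos (exp (- t))"

lemma DERIV_wkb_phase:
  assumes "t > 0"
  shows "(wkb_phase has_real_derivative sqrt (exp (2 * t) - 1)) (at t)"
proof -
  define s where "s = sqrt (exp (2 * t) - 1)"
  have s: "s > 0" "s\<^sup>2 = exp (2 * t) - 1" using assms by (simp_all add: s_def)
  have r: "sqrt (1 - (exp (- t))\<^sup>2) = s * exp (- t)"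
  proof (rule real_sqrt_unique)
    have "exp (2 * t) * (exp (- t))\<^sup>2 = 1" by (simp add: power2_eq_square mult_exp_exp)
    then show "(s * exp (- t))\<^sup>2 = 1 - (exp (- t))\<^sup>2"
      by (simp add: power_mult_distrib s(2) algebra_simps)
  qed (use s in simp)
  have "((\<lambda>t. arccos (exp (- t))) has_real_derivative
      inverse (- sqrt (1 - (exp (- t))\<^sup>2)) * (exp (- t) * (- 1))) (at t)"
    using assms
    by (intro DERIV_chain2[where f = arccos] DERIV_arccos)
       (auto intro!: derivative_eq_intros simp: less_trans[OF _ exp_gt_zero])
  moreover have "inverse (- sqrt (1 - (exp (- t))\<^sup>2)) * (exp (- t) * (- 1)) = 1 / s"
    unfolding r using s by (simp add: field_simps)
  ultimately have 1: "((\<lambda>t. arccos (exp (- t))) has_real_derivative 1 / s) (at t)" by simp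
  have 2: "((\<lambda>t. sqrt (exp (2 * t) - 1)) has_real_derivative exp (2 * t) / s) (at t)"
    using s(1) unfolding s_def by (auto intro!: derivative_eq_intros simp: field_simps)
  have "exp (2 * t) / s - 1 / s = s" using s by (simp add: field_simps power2_eq_square)
  then show ?thesis
    using DERIV_diff[OF 2 1] unfolding wkb_phase_def[abs_def] s_def by simp
qed

lemma continuous_wkb_phase: "continuous_on {0..} wkb_phase"
  unfolding wkb_phase_def[abs_def]
  by (intro continuous_intros) (auto intro: order_trans[OF _ exp_ge_zero])

lemma wkb_phase_0: "wkb_phase 0 = 0"
  by (simp add: wkb_phase_def)

text \<open>The derivative formula is for positive arguments, but the mean value theorem asks only
  for continuity at the ends, so \<open>s = 0\<close> is included.\<close>

lemma wkb_phase_MVT: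
  assumes "0 \<le> s" "s < t"
  obtains x where "s < x" "x < t" "wkb_phase t - wkb_phase s = (t - s) * sqrt (exp (2 * x) - 1)"
proof -
  have "\<exists>l x. s < x \<and> x < t \<and> (wkb_phase has_real_derivative l) (at x) \<and> wkb_phase t - wkb_phase s = (t - s) * l"
  proof (rule MVT[OF assms(2)])
    show "continuous_on {s..t} wkb_phase"
      by (rule continuous_on_subset[OF continuous_wkb_phase]) (use assms in auto)
    show "wkb_phase differentiable (at x)" if "s < x" "x < t" for x
      using DERIV_wkb_phase[of x] that assms real_differentiable_def by auto
  qed
  then obtain l x where x: "s < x" "x < t" "(wkb_phase has_real_derivative l) (at x)"
    "wkb_phase t - wkb_phase s = (t - s) * l" by blast
  then have "l = sqrt (exp (2 * x) - 1)" using DERIV_unique[OF x(3) DERIV_wkb_phase] assms by simp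
  then show ?thesis using that x by blast
qed

lemma wkb_phase_strict_mono:
  assumes "0 \<le> s" "s < t"
  shows "wkb_phase s < wkb_phase t"
proof -
  obtain x where x: "s < x" "x < t" "wkb_phase t - wkb_phase s = (t - s) * sqrt (exp (2 * x) - 1)"
    using wkb_phase_MVT[OF assms] .
  have "(t - s) * sqrt (exp (2 * x) - 1) > 0" using x(1) assms by simp
  then show ?thesis using x by simp
qed

lemma wkb_phase_bounds:
  assumes "0 \<le> s" "s < t"
  shows "(t - s) * sqrt (exp (2 * s) - 1) \<le> wkb_phase t - wkb_phase s"
    and "wkb_phase t - wkb_phase s \<le> (t - s) * sqrt (exp (2 * t) - 1)"
proof -
  obtain x where x: "s < x" "x < t" "wkb_phase t - wkb_phase s = (t - s) * sqrt (exp (2 * x) - 1)"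
    using wkb_phase_MVT[OF assms] .
  show "(t - s) * sqrt (exp (2 * s) - 1) \<le> wkb_phase t - wkb_phase s"
    unfolding x(3) using x(1) assms by (intro mult_left_mono) auto
  show "wkb_phase t - wkb_phase s \<le> (t - s) * sqrt (exp (2 * t) - 1)"
    unfolding x(3) using x(2) assms by (intro mult_left_mono) auto
qed

lemma wkb_phase_inverse:
  assumes "y > 0"
  obtains t where "t > 0" "wkb_phase t = y"
proof -
  \<comment> \<open>Beyond 1 the slope of the phase is at least 1, so the value \<open>y\<close> is
    reached by \<open>1 + y\<close>.\<close>
  define T where "T = 1 + y"
  have "exp (2 * 1) \<ge> (3::real)" using exp_ge_add_one_self[of "2::real"] by simp
  then have "1 \<le> sqrt (exp (2 * 1) - 1 :: real)" by (intro real_le_rsqrt) simp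
  then have "(T - 1) * 1 \<le> (T - 1) * sqrt (exp (2 * 1) - 1)"
    using assms by (intro mult_left_mono) (auto simp: T_def)
  also have "\<dots> \<le> wkb_phase T - wkb_phase 1"
    using assms by (intro wkb_phase_bounds) (auto simp: T_def)
  finally have "y \<le> wkb_phase T" using wkb_phase_strict_mono[of 0 1] by (simp add: T_def wkb_phase_0)
  moreover have "continuous_on {0..T} wkb_phase"
    by (rule continuous_on_subset[OF continuous_wkb_phase]) auto
  ultimately have "\<exists>t\<ge>0. t \<le> T \<and> wkb_phase t = y"
    using assms by (intro IVT') (auto simp: wkb_phase_0 T_def)
  then obtain t where "t \<ge> 0" "wkb_phase t = y" by blast
  moreover have "t \<noteq> 0" using \<open>wkb_phase t = y\<close> assms wkb_phase_0 by auto
  ultimately show ?thesis by (intro that[of t]) auto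
qed

text \<open>The substitution \<open>h = exp s\<close> turns the equation into
  \<open>wkb_phase s = pi / w\<close>, and strict monotonicity supplies the uniqueness that
  \<open>THE\<close> requires.\<close>

lemma h_fun_eq_exp:
  assumes "t > 0" "wkb_phase t = pi / w"
  shows "h_fun w = exp t"
  unfolding h_fun_def
proof (rule the_equality)
  have eq: "sqrt ((exp s)\<^sup>2 - 1) - arccos (1 / exp s) = wkb_phase s" for s
    by (simp add: wkb_phase_def exp_double exp_minus inverse_eq_divide)
  show "1 < exp t \<and> sqrt ((exp t)\<^sup>2 - 1) - arccos (1 / exp t) = pi / w"
    unfolding eq using assms by simp
  fix h :: real assume h: "1 < h \<and> sqrt (h\<^sup>2 - 1) - arccos (1 / h) = pi / w"
  define s where "s = ln h"
  have s: "h = exp s" "s > 0" using h by (simp_all add: s_def)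
  have "wkb_phase s = wkb_phase t" using h assms eq[of s] s by simp
  then have "s = t"
    using wkb_phase_strict_mono[of s t] wkb_phase_strict_mono[of t s] s assms by (cases s t rule: linorder_cases) auto
  then show "h = exp t" using s by simp
qed

section \<open>Zero counts compared with the WKB phase\<close>

context bessel_profile
begin

text \<open>On each of \<open>n\<close> equal subintervals the comparison errs by at most one zero, and the lower and upper Riemann
  sums of the monotone integrand differ by a telescoping sum.\<close>

lemma card_zeros_estimate:
  assumes "T > 0" and "n > (0::nat)"
  shows "\<bar>real (card (zeros 0 T)) - nu * wkb_phase T / pi\<bar>
    \<le> real n + nu * (T * sqrt (exp (2 * T) - 1)) / (pi * real n)"
proof -
  define \<tau> where "\<tau> = (\<lambda>i::nat. real i * (T / real n))"
  define \<sigma> where "\<sigma> = (\<lambda>t::real. sqrt (exp (2 * t) - 1))"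
  have step: "\<tau> (Suc i) - \<tau> i = T / real n" for i by (simp add: \<tau>_def algebra_simps add_divide_distrib)
  have \<tau>_less: "\<tau> i < \<tau> (Suc i)" for i using step[of i] assms by (smt (verit) divide_pos_pos of_nat_0_less_iff)
  have \<tau>_ge: "\<tau> i \<ge> 0" for i using assms by (simp add: \<tau>_def)
  have ends: "\<tau> 0 = 0" "\<tau> n = T" using assms by (simp_all add: \<tau>_def)
  \<comment> \<open>Induction invariant: each subinterval adds at most 1 to the error, and a Riemann
    error of at most \<open>nu * (T / n) / pi\<close> times the increment of \<sigma>. The latter
    telescopes to the endpoint value of \<sigma>.\<close>
  have "real (card (zeros 0 (\<tau> i))) \<le> nu * wkb_phase (\<tau> i) / pi + real i + nu * (T / real n) * \<sigma> (\<tau> i) / pi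
     \<and> nu * wkb_phase (\<tau> i) / pi - real i - nu * (T / real n) * \<sigma> (\<tau> i) / pi \<le> real (card (zeros 0 (\<tau> i)))
     \<and> finite (zeros 0 (\<tau> i))" for i
  proof (induction i)
    case 0
    have "zeros 0 0 = {}" by (auto simp: zeros_def)
    then show ?case using ends by (simp add: wkb_phase_0 \<sigma>_def)
  next
    case (Suc i)
    define Z where "Z = zeros (\<tau> i) (\<tau> (Suc i))"
    have un: "zeros 0 (\<tau> (Suc i)) = zeros 0 (\<tau> i) \<union> Z" and dj: "zeros 0 (\<tau> i) \<inter> Z = {}"
      unfolding Z_def zeros_def using \<tau>_less[of i] \<tau>_ge[of i] by auto
    have fin: "finite Z" unfolding Z_def by (rule zeros_upper(1)[OF \<tau>_ge \<tau>_less])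
    have card: "card (zeros 0 (\<tau> (Suc i))) = card (zeros 0 (\<tau> i)) + card Z"
      unfolding un using Suc.IH fin dj by (intro card_Un_disjoint) auto
    have up: "real (card Z) \<le> nu * (T / real n) * \<sigma> (\<tau> (Suc i)) / pi + 1"
      using zeros_upper(2)[OF \<tau>_ge \<tau>_less, of i] unfolding Z_def step \<sigma>_def by (simp add: ac_simps)
    have lo: "nu * (T / real n) * \<sigma> (\<tau> i) / pi - 1 \<le> real (card Z)"
      using zeros_lower[OF \<tau>_ge \<tau>_less, of i] unfolding Z_def step \<sigma>_def by (simp add: ac_simps)
    have "nu * (T / real n * \<sigma> (\<tau> i)) \<le> nu * (wkb_phase (\<tau> (Suc i)) - wkb_phase (\<tau> i))"
      "nu * (wkb_phase (\<tau> (Suc i)) - wkb_phase (\<tau> i)) \<le> nu * (T / real n * \<sigma> (\<tau> (Suc i)))"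
      using wkb_phase_bounds[OF \<tau>_ge \<tau>_less, of i, unfolded step] nu_pos unfolding \<sigma>_def
      by (meson mult_left_mono less_imp_le)+
    then have "nu * (T / real n * \<sigma> (\<tau> i)) / pi \<le> nu * (wkb_phase (\<tau> (Suc i)) - wkb_phase (\<tau> i)) / pi"
      "nu * (wkb_phase (\<tau> (Suc i)) - wkb_phase (\<tau> i)) / pi \<le> nu * (T / real n * \<sigma> (\<tau> (Suc i))) / pi"
      by (meson divide_right_mono pi_ge_zero)+
    then have "nu * (T / real n) * \<sigma> (\<tau> i) / pi \<le> nu * wkb_phase (\<tau> (Suc i)) / pi - nu * wkb_phase (\<tau> i) / pi"
      "nu * wkb_phase (\<tau> (Suc i)) / pi - nu * wkb_phase (\<tau> i) / pi \<le> nu * (T / real n) * \<sigma> (\<tau> (Suc i)) / pi"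
      by (simp_all add: right_diff_distrib diff_divide_distrib mult.assoc)
    then show ?case using Suc.IH up lo card un fin by auto
  qed
  from this[of n] show ?thesis unfolding ends \<sigma>_def using pi_gt_zero
    by (simp add: abs_le_iff field_simps)
qed

end

section \<open>Concentration and zero asymptotics\<close>

text \<open>The maximum over \<open>{0..a}\<close> is global. Left of 0 the profile increases; right
  of \<open>a\<close> the chain
  \<open>(f t)^2 \<le> sonin t \<le> sonin a \<le> sonin c = (f c)^2\<close> leads back to a
  critical point \<open>c\<close> in the interval.\<close>

lemma (in bessel_profile) profile_max:
  assumes "a > 0" and "nu\<^sup>2 * (exp a - 1) * a\<^sup>2 > 4"
  obtains t0 where "0 \<le> t0" "t0 \<le> a" "f t0 \<noteq> 0" "\<And>t. \<bar>f t\<bar> \<le> \<bar>f t0\<bar>" "sonin a \<le> (f t0)\<^sup>2"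
proof -
  obtain c where c: "0 < c" "c \<le> a" "f1 c = 0" using critical_point[OF assms] .
  have "continuous_on {0..a} (\<lambda>t. \<bar>f t\<bar>)" by (intro continuous_intros continuous_f)
  then have "\<exists>x\<in>{0..a}. \<forall>y\<in>{0..a}. \<bar>f y\<bar> \<le> \<bar>f x\<bar>"
    using assms(1) by (intro continuous_attains_sup) auto
  then obtain t0 where t0: "t0 \<in> {0..a}" "\<And>y. y \<in> {0..a} \<Longrightarrow> \<bar>f y\<bar> \<le> \<bar>f t0\<bar>" by blast
  have "(f c)\<^sup>2 \<le> (f t0)\<^sup>2" using t0(2)[of c] c by (intro abs_le_square_iff[THEN iffD1]) auto
  moreover have "sonin a \<le> sonin c" by (rule sonin_antimono) (use c in auto)
  moreover have "sonin c = (f c)\<^sup>2" using c by (simp add: sonin_def)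
  ultimately have son: "sonin a \<le> (f t0)\<^sup>2" by simp
  have f0: "f 0 > 0" by (rule f_f1_pos) simp
  have f0_le: "f 0 \<le> \<bar>f t0\<bar>" using t0(2)[of 0] assms(1) f0 by simp
  have max: "\<bar>f t\<bar> \<le> \<bar>f t0\<bar>" for t
  proof -
    consider "t \<le> 0" | "t \<in> {0..a}" | "t \<ge> a" by fastforce
    then show ?thesis
    proof cases
      case 1
      then show ?thesis using f_mono_left[of t 0] f_f1_pos(1)[of t] f0_le by simp
    next
      case 2
      then show ?thesis by (rule t0(2))
    next
      case 3
      have "(f t)\<^sup>2 \<le> sonin t" using sonin_ge[of t] 3 assms(1) by simp
      also have "\<dots> \<le> sonin a" using sonin_antimono[of a t] 3 assms(1) by simp
      also note son
      finally show ?thesis by (simp add: abs_le_square_iff)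
    qed
  qed
  show ?thesis
    by (rule that[of t0]) (use t0(1) f0 f0_le max son in auto)
qed

text \<open>The threshold for \<open>nu\<close> is uniform over all profiles. The weight
  \<open>exp (- a0 * t)\<close> is the radial power of the eigenfunction in the logarithmic
  variable, and the bound \<open>M\<close> later keeps the suprema finite.\<close>

lemma bessel_profile_concentration:
  fixes a0 \<delta> \<eta> :: real
  assumes "a0 \<ge> 0" "\<delta> > 0" "\<eta> > 0"
  shows "eventually (\<lambda>nu. \<forall>f f1. bessel_profile nu f f1 \<longrightarrow> (\<exists>t0. 0 \<le> t0 \<and> t0 \<le> \<delta> \<and> f t0 \<noteq> 0
     \<and> (\<forall>t. \<delta> \<le> \<bar>t\<bar> \<longrightarrow> exp (- a0 * t) * \<bar>f t\<bar> \<le> \<eta> * (exp (- a0 * t0) * \<bar>f t0\<bar>))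
     \<and> (\<exists>M. \<forall>t. exp (- a0 * t) * \<bar>f t\<bar> \<le> M))) at_top"
proof -
  define s where "s = (\<lambda>t::real. sqrt (exp (2 * t) - 1))"
  have s\<delta>: "s \<delta> > 0" using assms by (simp add: s_def)
  have "((\<lambda>a. 3 * exp 1 * s a) \<longlongrightarrow> 3 * exp 1 * s 0) (at_right 0)"
    unfolding s_def by (intro tendsto_intros)
  then have "((\<lambda>a. 3 * exp 1 * s a) \<longlongrightarrow> 0) (at_right 0)" by (simp add: s_def)
  moreover have "0 < \<eta>\<^sup>2 * s \<delta>" using assms s\<delta> by simp
  ultimately have "eventually (\<lambda>a. 3 * exp 1 * s a < \<eta>\<^sup>2 * s \<delta>) (at_right 0)"
    by (rule order_tendstoD)
  moreover have "eventually (\<lambda>a. a \<in> {0<..<\<delta>}) (at_right 0)"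
    by (rule eventually_at_right_real) (use assms in simp)
  ultimately have "eventually (\<lambda>a. 3 * exp 1 * s a < \<eta>\<^sup>2 * s \<delta> \<and> a \<in> {0<..<\<delta>}) (at_right 0)"
    by (rule eventually_conj)
  \<comment> \<open>\<open>a\<close> is fixed before \<open>nu\<close> grows: it makes the amplitude
    ratio \<open>3 * exp 1 * s a / s \<delta>\<close> from \<open>wkb_decay\<close> smaller than
    \<open>\<eta>^2\<close>.\<close>
  then obtain a where a: "3 * exp 1 * s a < \<eta>\<^sup>2 * s \<delta>" "0 < a" "a < \<delta>"
    using eventually_happens' trivial_limit_at_right_real by (metis (lifting) greaterThanLessThan_iff)
  define b where "b = sqrt (1 - exp (- \<delta>))"
  have "b > 0" using assms by (simp add: b_def)
  define Q where "Q = (exp a - 1) * a\<^sup>2"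
  have "Q > 0" using a by (simp add: Q_def)
  have "filterlim (\<lambda>nu. nu\<^sup>2 * Q) at_top at_top" using \<open>Q > 0\<close> by real_asymp
  then have ev1: "eventually (\<lambda>nu. nu\<^sup>2 * Q > 4) at_top" by (rule filterlim_at_top_dense[THEN iffD1, rule_format])
  have ev2: "eventually (\<lambda>nu. 1 / s a + 1 / s a ^ 3 \<le> nu) at_top" by (rule eventually_ge_at_top)
  have "filterlim (\<lambda>nu. nu * b) at_top at_top" using \<open>b > 0\<close> by real_asymp
  then have ev3: "eventually (\<lambda>nu. a0 \<le> nu * b) at_top" by (simp add: filterlim_at_top)
  \<comment> \<open>The second factor \<open>exp (a0 * \<delta>)\<close> is the cost of passing from
    \<open>\<bar>f t0\<bar>\<close> to the weighted peak value \<open>V\<close>.\<close>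
  have "((\<lambda>nu. exp (a0 * \<delta> - nu * b * \<delta> / 2) * exp (a0 * \<delta>)) \<longlongrightarrow> 0) at_top"
    using \<open>b > 0\<close> \<open>\<delta> > 0\<close> by real_asymp
  then have ev4: "eventually (\<lambda>nu. exp (a0 * \<delta> - nu * b * \<delta> / 2) * exp (a0 * \<delta>) < \<eta>) at_top"
    by (rule order_tendstoD) (use assms in simp)
  show ?thesis
    using ev1 ev2 ev3 ev4
  proof eventually_elim
    case (elim nu)
    show ?case
    proof (intro allI impI)
      fix f f1 assume bp: "bessel_profile nu f f1"
      interpret bessel_profile nu f f1 by fact
      have "nu\<^sup>2 * (exp a - 1) * a\<^sup>2 > 4" using elim(1) by (simp add: Q_def mult.assoc)
      then obtain t0 where t0: "0 \<le> t0" "t0 \<le> a" "f t0 \<noteq> 0" "\<And>t. \<bar>f t\<bar> \<le> \<bar>f t0\<bar>" "sonin a \<le> (f t0)\<^sup>2"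
        using profile_max[OF a(2)] by blast
      define V where "V = exp (- a0 * t0) * \<bar>f t0\<bar>"
      have ft0: "\<bar>f t0\<bar> \<le> exp (a0 * \<delta>) * V"
      proof -
        have "a0 * t0 \<le> a0 * \<delta>" using t0 a assms by (intro mult_left_mono) auto
        then have "exp 0 * \<bar>f t0\<bar> \<le> exp (a0 * \<delta> - a0 * t0) * \<bar>f t0\<bar>" by (intro mult_right_mono) auto
        also have "\<dots> = exp (a0 * \<delta>) * V" unfolding V_def by (simp add: exp_diff exp_minus field_simps)
        finally show ?thesis by simp
      qed
      have V0: "V \<ge> 0" by (simp add: V_def)
      have right: "exp (- a0 * t) * \<bar>f t\<bar> \<le> \<eta> * V" if "t \<ge> \<delta>" for t
      proof -
        have "s \<delta> * (f t)\<^sup>2 \<le> s \<delta> * sonin \<delta>"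
          using sonin_ge[of t] sonin_antimono[of \<delta> t] that assms s\<delta> by (intro mult_left_mono) auto
        also have "\<dots> \<le> 3 * exp 1 * (s a * sonin a)"
          by (rule wkb_decay[OF a(2) s_def]) (use elim a in auto)
        also have "\<dots> \<le> 3 * exp 1 * (s a * (f t0)\<^sup>2)"
          using t0(5) a by (intro mult_left_mono) (auto simp: s_def)
        also have "\<dots> = 3 * exp 1 * s a * (f t0)\<^sup>2" by simp
        also have "\<dots> \<le> \<eta>\<^sup>2 * s \<delta> * (f t0)\<^sup>2" using a(1) by (intro mult_right_mono) auto
        also have "\<dots> = s \<delta> * (\<eta> * f t0)\<^sup>2" by (simp add: power_mult_distrib)
        finally have "(f t)\<^sup>2 \<le> (\<eta> * f t0)\<^sup>2" using s\<delta> by (simp only: mult_le_cancel_left_pos)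
        then have "\<bar>f t\<bar> \<le> \<eta> * \<bar>f t0\<bar>" using assms by (simp add: abs_mult flip: abs_le_square_iff)
        moreover have "exp (- a0 * t) \<le> exp (- a0 * t0)"
        proof -
          have "a0 * t0 \<le> a0 * t" using that a t0 assms by (intro mult_left_mono) auto
          then show ?thesis by simp
        qed
        ultimately have "exp (- a0 * t) * \<bar>f t\<bar> \<le> exp (- a0 * t0) * (\<eta> * \<bar>f t0\<bar>)"
          by (intro mult_mono) auto
        then show ?thesis by (simp add: V_def ac_simps)
      qed
      have left: "exp (- a0 * t) * \<bar>f t\<bar> \<le> \<eta> * V" if "t \<le> - \<delta>" for t
      proof -
        have "f t > 0" using f_f1_pos(1)[of t] that assms by simp
        then have "exp (- a0 * t) * \<bar>f t\<bar> \<le> exp (a0 * \<delta> - nu * b * \<delta> / 2) * f 0"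
          using left_decay[OF b_def \<open>\<delta> > 0\<close> elim(3) that] by simp
        also have "\<dots> \<le> exp (a0 * \<delta> - nu * b * \<delta> / 2) * (exp (a0 * \<delta>) * V)"
          using t0(4)[of 0] ft0 by (intro mult_left_mono) auto
        also have "\<dots> = exp (a0 * \<delta> - nu * b * \<delta> / 2) * exp (a0 * \<delta>) * V" by simp
        also have "\<dots> \<le> \<eta> * V" using elim(4) V0 by (intro mult_right_mono) auto
        finally show ?thesis .
      qed
      have mid: "exp (- a0 * t) * \<bar>f t\<bar> \<le> exp (a0 * \<delta>) * \<bar>f t0\<bar>" if "\<bar>t\<bar> < \<delta>" for t
      proof -
        have "a0 * (- t) \<le> a0 * \<delta>" using that assms by (intro mult_left_mono) auto
        then show ?thesis using t0(4)[of t] by (intro mult_mono) auto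
      qed
      have far: "exp (- a0 * t) * \<bar>f t\<bar> \<le> \<eta> * V" if "\<delta> \<le> \<bar>t\<bar>" for t
        using left[of t] right[of t] that by linarith
      have "exp (- a0 * t) * \<bar>f t\<bar> \<le> max (\<eta> * V) (exp (a0 * \<delta>) * \<bar>f t0\<bar>)" for t
        using far[of t] mid[of t] by linarith
      then show "\<exists>t0. 0 \<le> t0 \<and> t0 \<le> \<delta> \<and> f t0 \<noteq> 0
         \<and> (\<forall>t. \<delta> \<le> \<bar>t\<bar> \<longrightarrow> exp (- a0 * t) * \<bar>f t\<bar> \<le> \<eta> * (exp (- a0 * t0) * \<bar>f t0\<bar>))
         \<and> (\<exists>M. \<forall>t. exp (- a0 * t) * \<bar>f t\<bar> \<le> M)"
        using t0 a far by (intro exI[of _ t0] conjI exI[of _ "max (\<eta> * V) (exp (a0 * \<delta>) * \<bar>f t0\<bar>)"]) (auto simp: V_def)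
    qed
  qed
qed

section \<open>Positive zeros of the Bessel function and their asymptotics\<close>

definition bessel_zeros_upto :: "real \<Rightarrow> real \<Rightarrow> real set" where
  "bessel_zeros_upto nu Y = {y. 0 < y \<and> y \<le> Y \<and> bessel_J nu y = 0}"

text \<open>The profile is positive for \<open>t \<le> 0\<close>, that is, there is no zero in
  \<open>{0<..nu}\<close>; counting from \<open>t = 0\<close> therefore misses nothing.\<close>

lemma bessel_zeros_upto_eq:
  assumes "nu > 0" and "bessel_profile nu (\<lambda>t. bessel_J nu (nu * exp t)) f1"
  shows "bessel_zeros_upto nu (nu * exp T) = (\<lambda>t. nu * exp t) ` bessel_profile.zeros (\<lambda>t. bessel_J nu (nu * exp t)) 0 T"
proof -
  interpret bessel_profile nu "\<lambda>t. bessel_J nu (nu * exp t)" f1 by fact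
  show ?thesis
  proof (intro equalityI subsetI)
    fix y assume y: "y \<in> bessel_zeros_upto nu (nu * exp T)"
    define t where "t = ln (y / nu)"
    have t: "y = nu * exp t" using y assms by (simp add: t_def bessel_zeros_upto_def)
    then have "t \<le> T" using y assms by (simp add: bessel_zeros_upto_def)
    moreover have "0 < t" using f_f1_pos(1)[of t] y t by (cases "t \<le> 0") (auto simp: bessel_zeros_upto_def)
    ultimately have "t \<in> zeros 0 T" using y t by (simp add: zeros_def bessel_zeros_upto_def)
    then show "y \<in> (\<lambda>t. nu * exp t) ` zeros 0 T" using t by blast
  next
    fix y assume "y \<in> (\<lambda>t. nu * exp t) ` zeros 0 T"
    then show "y \<in> bessel_zeros_upto nu (nu * exp T)"
      using assms by (auto simp: zeros_def bessel_zeros_upto_def)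
  qed
qed

lemma finite_bessel_zeros_upto:
  assumes "nu > 0"
  shows "finite (bessel_zeros_upto nu Y)"
proof -
  obtain f1 where bp: "bessel_profile nu (\<lambda>t. bessel_J nu (nu * exp t)) f1"
    using bessel_profile_bessel_J[OF assms] .
  \<comment> \<open>The maximum with \<open>nu * exp 1\<close> makes \<open>T\<close> positive, so
    that \<open>zeros_upper\<close> applies to a nondegenerate interval.\<close>
  define T where "T = ln (max (nu * exp 1) Y / nu)"
  have m: "max (nu * exp 1) Y > 0" using assms by (simp add: less_max_iff_disj)
  have "exp T = max (nu * exp 1) Y / nu" unfolding T_def using m assms by simp
  then have T: "nu * exp T = max (nu * exp 1) Y" using assms by simp
  have "nu * exp 1 \<le> nu * exp T" unfolding T by simp
  then have "T > 0" using assms by simp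
  have "finite (bessel_zeros_upto nu (nu * exp T))"
    unfolding bessel_zeros_upto_eq[OF assms bp]
    using bessel_profile.zeros_upper(1)[OF bp order_refl \<open>T > 0\<close>] by simp
  moreover have "bessel_zeros_upto nu Y \<subseteq> bessel_zeros_upto nu (nu * exp T)"
    unfolding T by (auto simp: bessel_zeros_upto_def)
  ultimately show ?thesis by (rule finite_subset[rotated])
qed

lemma bessel_zeros_upto_asymp:
  assumes "T > 0" "e > 0"
  shows "eventually (\<lambda>nu. \<bar>real (card (bessel_zeros_upto nu (nu * exp T))) / nu - wkb_phase T / pi\<bar> < e) at_top"
proof -
  define X where "X = T * sqrt (exp (2 * T) - 1) / pi"
  \<comment> \<open>First \<open>n\<close> makes the Riemann error less than \<open>e / 2\<close>;
    then \<open>nu > 2 * n / e\<close> does the same for the counting error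
    \<open>n / nu\<close>.\<close>
  obtain n where n: "real n > 2 * X / e" using reals_Archimedean2 by blast
  have "X > 0" using assms by (simp add: X_def)
  then have "0 < 2 * X / e" using assms by simp
  then have n0: "n > 0" using n by (cases n) auto
  have Xn: "X / real n < e / 2" using n n0 assms by (simp add: field_simps)
  show ?thesis
    using eventually_gt_at_top[of "2 * real n / e"] eventually_gt_at_top[of 0]
  proof eventually_elim
    case (elim nu)
    obtain f1 where bp: "bessel_profile nu (\<lambda>t. bessel_J nu (nu * exp t)) f1"
      using bessel_profile_bessel_J[OF elim(2)] .
    have card: "card (bessel_zeros_upto nu (nu * exp T)) = card (bessel_profile.zeros (\<lambda>t. bessel_J nu (nu * exp t)) 0 T)"
      (is "_ = ?N")
      unfolding bessel_zeros_upto_eq[OF elim(2) bp] using elim(2) by (intro card_image inj_onI) simp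
    have "\<bar>real ?N - nu * wkb_phase T / pi\<bar> \<le> real n + nu * (T * sqrt (exp (2 * T) - 1)) / (pi * real n)"
      by (rule bessel_profile.card_zeros_estimate[OF bp assms(1) n0])
    also have "\<dots> = real n + nu * (X / real n)" by (simp add: X_def)
    finally have "\<bar>real ?N - nu * wkb_phase T / pi\<bar> / nu \<le> (real n + nu * (X / real n)) / nu"
      using elim(2) by (intro divide_right_mono) auto
    also have "\<dots> = real n / nu + X / real n" using elim(2) by (simp add: add_divide_distrib)
    also have "\<dots> < e"
    proof -
      have "real n / nu < e / 2" using elim assms by (simp add: field_simps)
      then show ?thesis using Xn by linarith
    qed
    finally have "\<bar>real ?N - nu * wkb_phase T / pi\<bar> / nu < e" .
    moreover have "\<bar>real ?N - nu * wkb_phase T / pi\<bar> / nu = \<bar>real ?N / nu - wkb_phase T / pi\<bar>"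
    proof -
      have "real ?N / nu - wkb_phase T / pi = (real ?N - nu * wkb_phase T / pi) / nu"
        using elim(2) by (simp add: diff_divide_distrib)
      then show ?thesis using elim(2) by (simp only: abs_divide abs_of_pos)
    qed
    ultimately show ?case unfolding card by simp
  qed
qed

lemma finite_set_kth_element:
  fixes A :: "'a::linorder set"
  assumes "finite A" "1 \<le> k" "k \<le> card A"
  shows "\<exists>z\<in>A. card {y\<in>A. y \<le> z} = k"
  using assms
proof (induction A rule: finite_linorder_max_induct)
  case (insert b A)
  show ?case
  proof (cases "k \<le> card A")
    case True
    then obtain z where z: "z \<in> A" "card {y\<in>A. y \<le> z} = k" using insert by blast
    have "{y \<in> insert b A. y \<le> z} = {y\<in>A. y \<le> z}" using insert z by fastforce
    then show ?thesis using z by (intro bexI[of _ z]) auto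
  next
    case False
    then have "k = card (insert b A)" using insert by (simp add: card_insert_if split: if_splits)
    moreover have "{y \<in> insert b A. y \<le> b} = insert b A" using insert by fastforce
    ultimately show ?thesis by (intro bexI[of _ b]) auto
  qed
qed simp

text \<open>The counting function jumps at every zero, so at most one zero has count
  \<open>k\<close>, and a \<open>k\<close>-th element of the finite set exists by hypothesis. This
  makes the \<open>THE\<close> in \<open>bessel_zero\<close> meaningful.\<close>

lemma bessel_zero_props:
  assumes "nu > 0" "1 \<le> k" "k \<le> card (bessel_zeros_upto nu Y)"
  shows "0 < bessel_zero nu k" "bessel_zero nu k \<le> Y"
    "card (bessel_zeros_upto nu (bessel_zero nu k)) = k"
proof -
  have fin: "finite (bessel_zeros_upto nu y)" for y by (rule finite_bessel_zeros_upto[OF assms(1)])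
  obtain z where z: "z \<in> bessel_zeros_upto nu Y" "card {y \<in> bessel_zeros_upto nu Y. y \<le> z} = k"
    using finite_set_kth_element[OF fin assms(2,3)] by blast
  have "{y \<in> bessel_zeros_upto nu Y. y \<le> z} = bessel_zeros_upto nu z"
    using z(1) by (auto simp: bessel_zeros_upto_def)
  then have card_z: "card (bessel_zeros_upto nu z) = k" using z(2) by simp
  have "bessel_zero nu k = z"
    unfolding bessel_zero_def bessel_zeros_upto_def[symmetric]
  proof (rule the_equality)
    show "0 < z \<and> bessel_J nu z = 0 \<and> card (bessel_zeros_upto nu z) = k"
      using z(1) card_z by (simp add: bessel_zeros_upto_def)
    fix x assume x: "0 < x \<and> bessel_J nu x = 0 \<and> card (bessel_zeros_upto nu x) = k"
    have less: "card (bessel_zeros_upto nu u) < card (bessel_zeros_upto nu v)"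
      if "u < v" "0 < v" "bessel_J nu v = 0" for u v
    proof (rule psubset_card_mono[OF fin])
      have "v \<in> bessel_zeros_upto nu v" "v \<notin> bessel_zeros_upto nu u"
        using that by (auto simp: bessel_zeros_upto_def)
      moreover have "bessel_zeros_upto nu u \<subseteq> bessel_zeros_upto nu v"
        using that by (auto simp: bessel_zeros_upto_def)
      ultimately show "bessel_zeros_upto nu u \<subset> bessel_zeros_upto nu v" by blast
    qed
    show "x = z"
      using less[of x z] less[of z x] x z(1) card_z
      by (cases x z rule: linorder_cases) (auto simp: bessel_zeros_upto_def)
  qed
  then show "0 < bessel_zero nu k" "bessel_zero nu k \<le> Y"
    "card (bessel_zeros_upto nu (bessel_zero nu k)) = k"
    using z(1) card_z by (auto simp: bessel_zeros_upto_def)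
qed

text \<open>By strict monotonicity of the phase, the count up to \<open>nus n * exp S\<close>
  eventually exceeds \<open>ks n\<close> if \<open>S > T\<close> and stays below it if
  \<open>S < T\<close>. This traps the zero on both sides.\<close>

lemma bessel_zero_asymp:
  fixes nus :: "nat \<Rightarrow> real" and ks :: "nat \<Rightarrow> nat"
  assumes nus: "filterlim nus at_top sequentially"
    and ks: "filterlim ks at_top sequentially"
    and ratio: "(\<lambda>n. real (ks n) / nus n) \<longlonglongrightarrow> wkb_phase T / pi"
    and "T > 0"
  shows "(\<lambda>n. bessel_zero (nus n) (ks n) / nus n) \<longlonglongrightarrow> exp T"
proof -
  have nu0: "eventually (\<lambda>n. nus n > 0) sequentially"
    using nus by (simp add: filterlim_at_top_dense)
  have k1: "eventually (\<lambda>n. ks n \<ge> 1) sequentially" using ks by (simp add: filterlim_at_top)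
  have count: "(\<lambda>n. real (card (bessel_zeros_upto (nus n) (nus n * exp S))) / nus n) \<longlonglongrightarrow> wkb_phase S / pi"
    if "S > 0" for S
  proof (rule tendstoI)
    fix e :: real assume "e > 0"
    from filterlim_iff[THEN iffD1, rule_format, OF nus bessel_zeros_upto_asymp[OF that this]]
    show "eventually (\<lambda>n. dist (real (card (bessel_zeros_upto (nus n) (nus n * exp S))) / nus n) (wkb_phase S / pi) < e) sequentially"
      by (simp add: dist_real_def)
  qed
  have up: "eventually (\<lambda>n. 0 < bessel_zero (nus n) (ks n) \<and> bessel_zero (nus n) (ks n) \<le> nus n * exp S
      \<and> card (bessel_zeros_upto (nus n) (bessel_zero (nus n) (ks n))) = ks n) sequentially"
    if "S > T" for S
  proof -
    have "wkb_phase T / pi < wkb_phase S / pi"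
      using wkb_phase_strict_mono[of T S] that \<open>T > 0\<close> by (simp add: divide_strict_right_mono)
    moreover have "S > 0" using that \<open>T > 0\<close> by simp
    ultimately have "eventually (\<lambda>n. 0 < real (card (bessel_zeros_upto (nus n) (nus n * exp S))) / nus n - real (ks n) / nus n) sequentially"
      by (intro order_tendstoD(1)[OF tendsto_diff[OF count ratio]]) auto
    then show ?thesis using nu0 k1
    proof eventually_elim
      case (elim n)
      then have "ks n \<le> card (bessel_zeros_upto (nus n) (nus n * exp S))"
        by (simp add: divide_less_cancel)
      then show ?case using bessel_zero_props[OF elim(2,3)] by blast
    qed
  qed
  have low: "eventually (\<lambda>n. nus n * exp S < bessel_zero (nus n) (ks n)) sequentially"
    if "0 < S" "S < T" for S
  proof -
    have "wkb_phase S / pi < wkb_phase T / pi"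
      using wkb_phase_strict_mono[of S T] that by (simp add: divide_strict_right_mono)
    then have "eventually (\<lambda>n. 0 < real (ks n) / nus n - real (card (bessel_zeros_upto (nus n) (nus n * exp S))) / nus n) sequentially"
      by (intro order_tendstoD(1)[OF tendsto_diff[OF ratio count[OF that(1)]]]) auto
    \<comment> \<open>The instance at \<open>T + 1\<close> ensures that the zero is well defined
      with count \<open>ks n\<close>.\<close>
    then show ?thesis using nu0 up[of "T + 1", simplified]
    proof eventually_elim
      case (elim n)
      then have less: "card (bessel_zeros_upto (nus n) (nus n * exp S)) < ks n"
        by (simp add: divide_less_cancel)
      show ?case
      proof (rule ccontr)
        assume "\<not> ?thesis"
        then have "bessel_zeros_upto (nus n) (bessel_zero (nus n) (ks n)) \<subseteq> bessel_zeros_upto (nus n) (nus n * exp S)"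
          by (auto simp: bessel_zeros_upto_def)
        then have "card (bessel_zeros_upto (nus n) (bessel_zero (nus n) (ks n))) \<le> card (bessel_zeros_upto (nus n) (nus n * exp S))"
          by (rule card_mono[OF finite_bessel_zeros_upto[OF elim(2)]])
        then show False using less elim(3) by simp
      qed
    qed
  qed
  show ?thesis
  proof (rule order_tendstoI)
    fix a assume a: "a < exp T"
    \<comment> \<open>Raising \<open>a\<close> to at least \<open>exp (T / 2)\<close> guarantees
      \<open>S > 0\<close> even when \<open>a\<close> is small or negative.\<close>
    define S where "S = ln (max a (exp (T / 2)))"
    have m: "max a (exp (T / 2)) > 0" by (simp add: less_max_iff_disj)
    have S: "exp S = max a (exp (T / 2))" unfolding S_def using m by simp
    have "exp S < exp T" unfolding S using a \<open>T > 0\<close> by simp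
    moreover have "exp (T / 2) \<le> exp S" unfolding S by simp
    ultimately have "S < T" "0 < S" using \<open>T > 0\<close> by simp_all
    have "eventually (\<lambda>n. nus n * exp S < bessel_zero (nus n) (ks n)) sequentially"
      by (rule low) fact+
    then show "eventually (\<lambda>n. a < bessel_zero (nus n) (ks n) / nus n) sequentially"
      using nu0
    proof eventually_elim
      case (elim n)
      then have "exp S < bessel_zero (nus n) (ks n) / nus n" by (simp add: pos_less_divide_eq mult.commute)
      then show ?case unfolding S by simp
    qed
  next
    fix a assume a: "exp T < a"
    define S where "S = (T + ln a) / 2"
    have "a > 0" using a exp_gt_zero[of T] by linarith
    then have "T < ln a" using a by (metis exp_less_cancel_iff exp_ln)
    then have S: "T < S" "S < ln a" by (simp_all add: S_def)
    then have "exp S < a" using \<open>a > 0\<close> by (metis exp_less_cancel_iff exp_ln)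
    from up[OF S(1)] nu0
    show "eventually (\<lambda>n. bessel_zero (nus n) (ks n) / nus n < a) sequentially"
    proof eventually_elim
      case (elim n)
      then have "bessel_zero (nus n) (ks n) / nus n \<le> exp S" by (simp add: pos_divide_le_eq mult.commute)
      then show ?case using \<open>exp S < a\<close> by simp
    qed
  qed
qed

section \<open>Eigenfunctions\<close>

text \<open>A polynomial is continuous and the sphere is compact. The maximizing direction lets the
  angular factor cancel from the quotient.\<close>

lemma spherical_harmonics_attains_sup:
  fixes Y :: "real ^ 'd \<Rightarrow> real"
  assumes "Y \<in> spherical_harmonics l"
  obtains \<xi> where "\<xi> \<in> sphere 0 1" "\<And>x. x \<in> sphere 0 1 \<Longrightarrow> \<bar>Y x\<bar> \<le> \<bar>Y \<xi>\<bar>"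
proof -
  obtain p where p: "homogeneous_poly l p" "\<forall>x\<in>sphere 0 1. Y x = p x"
    using assms by (auto simp: spherical_harmonics_def)
  obtain A :: "('d \<Rightarrow> nat) set" and a where "p = (\<lambda>x. \<Sum>\<alpha>\<in>A. a \<alpha> * (\<Prod>i\<in>UNIV. (x $ i) ^ (\<alpha> i)))"
    using p(1) by (auto simp: homogeneous_poly_def)
  then have "continuous_on (sphere 0 1) p" by (auto intro!: continuous_intros)
  then have "continuous_on (sphere 0 1) (\<lambda>x. \<bar>p x\<bar>)" by (intro continuous_intros)
  moreover have "sphere 0 1 \<noteq> ({} :: (real ^ 'd) set)"
    using vector_choose_size[of 1] by (metis dist_0_norm empty_iff mem_sphere zero_le_one)
  ultimately have "\<exists>\<xi>\<in>sphere 0 1. \<forall>x\<in>sphere 0 1. \<bar>p x\<bar> \<le> \<bar>p \<xi>\<bar>"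
    by (intro continuous_attains_sup) auto
  then show ?thesis using that p(2) by metis
qed

text \<open>A single witness \<open>x0\<close> bounds the denominator from below, once
  \<open>bounded\<close> guarantees that its \<open>Sup\<close> is a genuine upper bound.\<close>

lemma sup_norm_ratio_le:
  assumes "x0 \<in> B" "f x0 \<noteq> 0" "\<eta> \<ge> 0"
    and bounded: "\<And>x. x \<in> B \<Longrightarrow> \<bar>f x\<bar> \<le> M"
    and small: "\<And>x. x \<in> S \<Longrightarrow> \<bar>f x\<bar> \<le> \<eta> * \<bar>f x0\<bar>"
  shows "\<bar>sup_norm_on S f / sup_norm_on B f\<bar> \<le> \<eta>"
proof -
  have "0 \<le> M" using bounded[OF assms(1)] by linarith
  then have bdB: "bdd_above (insert 0 ((\<lambda>x. \<bar>f x\<bar>) ` B))" using bounded by (intro bdd_aboveI[of _ M]) auto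
  have bdS: "bdd_above (insert 0 ((\<lambda>x. \<bar>f x\<bar>) ` S))"
    using small assms(3) by (intro bdd_aboveI[of _ "\<eta> * \<bar>f x0\<bar>"]) auto
  have B: "\<bar>f x0\<bar> \<le> sup_norm_on B f"
    unfolding sup_norm_on_def using assms(1) by (intro cSup_upper bdB) auto
  have S0: "0 \<le> sup_norm_on S f"
    unfolding sup_norm_on_def by (intro cSup_upper bdS) auto
  have "sup_norm_on S f \<le> \<eta> * \<bar>f x0\<bar>"
    unfolding sup_norm_on_def using small assms(3) by (intro cSup_least) auto
  also have "\<dots> \<le> \<eta> * sup_norm_on B f" using B assms(3) by (intro mult_left_mono) auto
  finally have "sup_norm_on S f \<le> \<eta> * sup_norm_on B f" .
  moreover have "0 < sup_norm_on B f" using B assms(2) by linarith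
  ultimately show ?thesis using S0 by (simp add: pos_divide_le_eq)
qed

text \<open>Since \<open>ln (norm x) = t - ln (j / nu)\<close>, the radial power splits into a
  factor independent of \<open>x\<close>, which cancels from the quotient, and the weight of the
  concentration estimate.\<close>

lemma abs_eigfun_eq:
  fixes x :: "real ^ 'd"
  assumes "x \<noteq> 0" and j: "bessel_zero (nu_l CARD('d) c l) k = j" "j > 0"
    and nu: "nu = nu_l CARD('d) c l" "nu > 0"
    and t: "t = ln (norm x * j / nu)"
  shows "\<bar>eigfun c k l Y x\<bar> = exp ((real CARD('d) / 2 - 1) * ln (j / nu)) *
     (exp (- (real CARD('d) / 2 - 1) * t) * \<bar>bessel_J nu (nu * exp t)\<bar>) * \<bar>Y ((1 / norm x) *\<^sub>R x)\<bar>"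
proof -
  have r: "norm x > 0" using assms(1) by simp
  have et: "nu * exp t = j * norm x" unfolding t using r j(2) nu(2) by simp
  have "ln (norm x) = t - ln (j / nu)"
    unfolding t using r j(2) nu(2) by (simp add: ln_mult ln_div)
  then have "norm x powr (1 - real CARD('d) / 2) = exp ((1 - real CARD('d) / 2) * (t - ln (j / nu)))"
    using assms(1) by (simp add: powr_def)
  also have "(1 - real CARD('d) / 2) * (t - ln (j / nu))
      = (real CARD('d) / 2 - 1) * ln (j / nu) + - (real CARD('d) / 2 - 1) * t"
    by (simp only: left_diff_distrib right_diff_distrib mult_minus_left)
  finally have "norm x powr (1 - real CARD('d) / 2)
     = exp ((real CARD('d) / 2 - 1) * ln (j / nu)) * exp (- (real CARD('d) / 2 - 1) * t)"
    by (simp only: exp_add)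
  then show ?thesis
    unfolding eigfun_def Let_def et j(1)[symmetric] nu(1)[symmetric]
    by (simp add: abs_mult nu(1))
qed

text \<open>In HOL \<open>0 powr a\<close> is 0 for every \<open>a\<close>, including the exponent 0
  of dimension 2, so the origin contributes nothing to either supremum.\<close>

lemma eigfun_0: "eigfun c k l Y 0 = 0"
  by (simp add: eigfun_def)

lemma nu_l_asymp: "(\<lambda>l. nu_l d c l / real l) \<longlonglongrightarrow> 1"
  unfolding nu_l_def by real_asymp

lemma filterlim_nu_l: "filterlim (nu_l d c) at_top sequentially"
  unfolding nu_l_def[abs_def] by real_asymp

text \<open>The joint limit is expressed along arbitrary sequences. Harmonics that are nonzero on
  the sphere include the basis elements for every choice of \<open>m\<close>.\<close>

theorem theorem2p2:
  fixes c eps w :: real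
    and kseq lseq :: "nat \<Rightarrow> nat"
    and Yseq :: "nat \<Rightarrow> (real ^ 'd \<Rightarrow> real)"
  assumes "CARD('d) \<ge> 2" and "c \<ge> 0" and "eps > 0" and "w > 0"
    and "filterlim kseq at_top sequentially"
    and "filterlim lseq at_top sequentially"
    and "(\<lambda>n. real (lseq n) / real (kseq n)) \<longlonglongrightarrow> w"
    and "\<And>n. Yseq n \<in> spherical_harmonics (lseq n)"
    and "\<And>n. \<exists>x\<in>sphere 0 1. Yseq n x \<noteq> 0"
  shows "(\<lambda>n. sup_norm_on (D_set (1 / h_fun w) eps \<inter> ball 0 1) (eigfun c (kseq n) (lseq n) (Yseq n))
            / sup_norm_on (ball 0 1) (eigfun c (kseq n) (lseq n) (Yseq n))) \<longlonglongrightarrow> 0"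
proof -
  obtain T where T: "T > 0" "wkb_phase T = pi / w"
    using wkb_phase_inverse[of "pi / w"] assms(4) by auto
  have h: "1 / h_fun w = exp (- T)"
    using h_fun_eq_exp[OF T] by (simp add: exp_minus inverse_eq_divide)
  define nus where "nus = (\<lambda>n. nu_l CARD('d) c (lseq n))"
  define a0 where "a0 = real CARD('d) / 2 - 1"
  have "a0 \<ge> 0" using assms(1) by (simp add: a0_def)
  have nus: "filterlim nus at_top sequentially"
    unfolding nus_def by (rule filterlim_compose[OF filterlim_nu_l assms(6)])
  have nu0: "eventually (\<lambda>n. nus n > 0) sequentially" using nus by (simp add: filterlim_at_top_dense)
  have l1: "eventually (\<lambda>n. lseq n \<ge> 1) sequentially" using assms(6) by (simp add: filterlim_at_top)
  \<comment> \<open>As \<open>nu_l\<close> is asymptotic to \<open>l\<close>, the quotient tends to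
    \<open>1 / w\<close>, which is \<open>wkb_phase T / pi\<close> by the choice of
    \<open>T\<close>.\<close>
  have ratio: "(\<lambda>n. real (kseq n) / nus n) \<longlonglongrightarrow> wkb_phase T / pi"
  proof -
    have "(\<lambda>n. nus n / real (lseq n)) \<longlonglongrightarrow> 1"
      unfolding nus_def by (rule filterlim_compose[OF nu_l_asymp assms(6)])
    then have "(\<lambda>n. (nus n / real (lseq n)) * (real (lseq n) / real (kseq n))) \<longlonglongrightarrow> 1 * w"
      by (rule tendsto_mult) fact
    then have "(\<lambda>n. inverse ((nus n / real (lseq n)) * (real (lseq n) / real (kseq n)))) \<longlonglongrightarrow> inverse (1 * w)"
      by (rule tendsto_inverse) (use assms(4) in simp)
    moreover have "eventually (\<lambda>n. inverse ((nus n / real (lseq n)) * (real (lseq n) / real (kseq n))) = real (kseq n) / nus n) sequentially"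
      using l1 by eventually_elim simp
    ultimately have "(\<lambda>n. real (kseq n) / nus n) \<longlonglongrightarrow> inverse (1 * w)" by (rule Lim_transform_eventually)
    then show ?thesis unfolding T(2) using assms(4) by (simp add: field_simps)
  qed
  define js where "js = (\<lambda>n. bessel_zero (nus n) (kseq n))"
  have js: "(\<lambda>n. js n / nus n) \<longlonglongrightarrow> exp T"
    unfolding js_def by (rule bessel_zero_asymp[OF nus assms(5) ratio T(1)])
  have j0: "eventually (\<lambda>n. js n > 0) sequentially"
    using order_tendstoD(1)[OF js exp_gt_zero] nu0
    by eventually_elim (simp add: zero_less_divide_iff)
  have "(\<lambda>n. inverse (js n / nus n)) \<longlonglongrightarrow> inverse (exp T)" by (rule tendsto_inverse[OF js]) simp
  then have rho: "(\<lambda>n. nus n / js n) \<longlonglongrightarrow> exp (- T)" by (simp add: exp_minus)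
  show ?thesis
  proof (rule tendstoI)
    fix e :: real assume "e > 0"
    define \<eta> where "\<eta> = e / 2"
    have "\<eta> > 0" "\<eta> < e" using \<open>e > 0\<close> by (simp_all add: \<eta>_def)
    \<comment> \<open>\<delta> is chosen so that radii between \<open>exp (- T - \<delta>)\<close>
      and \<open>exp (- T + \<delta>)\<close> lie within \<open>eps\<close> of
      \<open>exp (- T)\<close> and below 1. Strictness leaves room to replace
      \<open>exp (- T)\<close> by \<open>nus n / js n\<close>.\<close>
    have lim: "((\<lambda>\<delta>. exp (- T) * exp \<delta>) \<longlongrightarrow> exp (- T) * exp 0) (at_right 0)"
      "((\<lambda>\<delta>. exp (- T) * exp (- \<delta>)) \<longlongrightarrow> exp (- T) * exp (- 0)) (at_right 0)"
      by (intro tendsto_intros)+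
    have "eventually (\<lambda>\<delta>. exp (- T) * exp \<delta> < min 1 (exp (- T) + eps)) (at_right 0)"
      using lim(1) by (rule order_tendstoD) (use T assms(3) in simp)
    moreover have "eventually (\<lambda>\<delta>. exp (- T) - eps < exp (- T) * exp (- \<delta>)) (at_right 0)"
      using lim(2) by (rule order_tendstoD) (use assms(3) in simp)
    moreover have "eventually (\<lambda>\<delta>. \<delta> > 0) (at_right (0::real))" by (rule eventually_at_right_less)
    ultimately have "eventually (\<lambda>\<delta>. exp (- T) * exp \<delta> < min 1 (exp (- T) + eps)
        \<and> exp (- T) - eps < exp (- T) * exp (- \<delta>) \<and> \<delta> > 0) (at_right 0)"
      by eventually_elim auto
    then obtain \<delta> where \<delta>: "exp (- T) * exp \<delta> < min 1 (exp (- T) + eps)"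
        "exp (- T) - eps < exp (- T) * exp (- \<delta>)" "\<delta> > 0"
      using eventually_happens' trivial_limit_at_right_real by blast
    have rho1: "eventually (\<lambda>n. nus n / js n * exp \<delta> < min 1 (exp (- T) + eps)) sequentially"
      by (rule order_tendstoD(2)[OF tendsto_mult_right[OF rho] \<delta>(1)])
    have rho2: "eventually (\<lambda>n. exp (- T) - eps < nus n / js n * exp (- \<delta>)) sequentially"
      by (rule order_tendstoD(1)[OF tendsto_mult_right[OF rho] \<delta>(2)])
    note conc = filterlim_iff[THEN iffD1, rule_format, OF nus
        bessel_profile_concentration[OF \<open>a0 \<ge> 0\<close> \<open>\<delta> > 0\<close> \<open>\<eta> > 0\<close>]]
    show "eventually (\<lambda>n. dist (sup_norm_on (D_set (1 / h_fun w) eps \<inter> ball 0 1) (eigfun c (kseq n) (lseq n) (Yseq n))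
            / sup_norm_on (ball 0 1) (eigfun c (kseq n) (lseq n) (Yseq n))) 0 < e) sequentially"
      using nu0 j0 rho1 rho2 conc
    proof eventually_elim
      case (elim n)
      define nu where "nu = nus n"
      define j where "j = js n"
      define u where "u = eigfun c (kseq n) (lseq n) (Yseq n)"
      define f where "f = (\<lambda>t. bessel_J nu (nu * exp t))"
      have pos: "nu > 0" "j > 0" using elim by (simp_all add: nu_def j_def)
      obtain f1 where "bessel_profile nu f f1"
        using bessel_profile_bessel_J[OF pos(1)] unfolding f_def .
      with elim(5) obtain t0 M where t0: "0 \<le> t0" "t0 \<le> \<delta>" "f t0 \<noteq> 0"
        and far: "\<And>t. \<delta> \<le> \<bar>t\<bar> \<Longrightarrow> exp (- a0 * t) * \<bar>f t\<bar> \<le> \<eta> * (exp (- a0 * t0) * \<bar>f t0\<bar>)"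
        and bnd: "\<And>t. exp (- a0 * t) * \<bar>f t\<bar> \<le> M"
        unfolding nu_def by blast
      obtain \<xi> where \<xi>: "\<xi> \<in> sphere 0 1" "\<And>x. x \<in> sphere 0 1 \<Longrightarrow> \<bar>Yseq n x\<bar> \<le> \<bar>Yseq n \<xi>\<bar>"
        using spherical_harmonics_attains_sup[OF assms(8)[of n]] by blast
      define m where "m = \<bar>Yseq n \<xi>\<bar>"
      have "m > 0" using assms(9)[of n] \<xi>(2) unfolding m_def by fastforce
      define C where "C = exp (a0 * ln (j / nu))"
      define \<tau> where "\<tau> = (\<lambda>x::real^'d. ln (norm x * j / nu))"
      have u_eq: "\<bar>u x\<bar> = C * (exp (- a0 * \<tau> x) * \<bar>f (\<tau> x)\<bar>) * \<bar>Yseq n ((1 / norm x) *\<^sub>R x)\<bar>" if "x \<noteq> 0" for x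
        unfolding u_def C_def f_def a0_def
        by (rule abs_eigfun_eq[OF that _ pos(2) _ pos(1)]) (simp_all add: j_def js_def nus_def nu_def \<tau>_def)
      have u_le: "\<bar>u x\<bar> \<le> C * (exp (- a0 * \<tau> x) * \<bar>f (\<tau> x)\<bar>) * m" if "x \<noteq> 0" for x
        unfolding u_eq[OF that] m_def using that by (intro mult_left_mono \<xi>(2)) (auto simp: C_def)
      have C: "C > 0" by (simp add: C_def)
      \<comment> \<open>The radius puts the logarithmic variable at the peak \<open>t0\<close>, and
        the direction maximizes the angular factor, whose value there is the bound \<open>m\<close>
        used everywhere else.\<close>
      define x0 where "x0 = (nu / j * exp t0) *\<^sub>R \<xi>"
      have nx0: "norm x0 = nu / j * exp t0" using \<xi>(1) pos by (simp add: x0_def)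
      have x0: "x0 \<noteq> 0" "\<tau> x0 = t0" "(1 / norm x0) *\<^sub>R x0 = \<xi>"
      proof -
        show "x0 \<noteq> 0" using nx0 pos by (metis divide_pos_pos exp_gt_zero mult_pos_pos norm_zero order_less_irrefl)
        show "\<tau> x0 = t0" unfolding \<tau>_def nx0 using pos by simp
        show "(1 / norm x0) *\<^sub>R x0 = \<xi>" unfolding nx0 unfolding x0_def using pos by simp
      qed
      have u0: "\<bar>u x0\<bar> = C * (exp (- a0 * t0) * \<bar>f t0\<bar>) * m"
        unfolding u_eq[OF x0(1)] x0 m_def ..
      have "\<bar>sup_norm_on (D_set (1 / h_fun w) eps \<inter> ball 0 1) u / sup_norm_on (ball 0 1) u\<bar> \<le> \<eta>"
      proof (rule sup_norm_ratio_le[of x0 _ u _ "C * M * m"])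
        have "nu / j * exp t0 \<le> nu / j * exp \<delta>" using pos t0 by (intro mult_left_mono) auto
        then show "x0 \<in> ball 0 1" using nx0 elim(3) by (simp add: nu_def j_def)
        have "\<bar>u x0\<bar> > 0" unfolding u0 using C \<open>m > 0\<close> t0(3) by simp
        then show "u x0 \<noteq> 0" by simp
        show "\<eta> \<ge> 0" using \<open>\<eta> > 0\<close> by simp
        show "\<bar>u x\<bar> \<le> C * M * m" if "x \<in> ball 0 1" for x
        proof (cases "x = 0")
          case True
          have "0 \<le> M" using bnd[of 0] by (smt (verit) exp_gt_zero mult_nonneg_nonneg abs_ge_zero)
          then show ?thesis using True C \<open>m > 0\<close> by (simp add: u_def eigfun_0)
        next
          case False
          have "C * (exp (- a0 * \<tau> x) * \<bar>f (\<tau> x)\<bar>) * m \<le> C * M * m"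
            using C \<open>m > 0\<close> by (intro mult_right_mono mult_left_mono bnd) auto
          then show ?thesis using u_le[OF False] by linarith
        qed
        show "\<bar>u x\<bar> \<le> \<eta> * \<bar>u x0\<bar>" if x: "x \<in> D_set (1 / h_fun w) eps \<inter> ball 0 1" for x
        proof (cases "x = 0")
          case True
          then show ?thesis using \<open>\<eta> > 0\<close> by (simp add: u_def eigfun_0)
        next
          case False
          have nx: "norm x = nu / j * exp (\<tau> x)" unfolding \<tau>_def using False pos by simp
          \<comment> \<open>Otherwise the radius would be within \<open>eps\<close> of
            \<open>exp (- T)\<close>, which \<open>D_set\<close> excludes.\<close>
          have "\<delta> \<le> \<bar>\<tau> x\<bar>"
          proof (rule ccontr)
            assume "\<not> ?thesis"
            then have "nu / j * exp (\<tau> x) \<le> nu / j * exp \<delta>" "nu / j * exp (- \<delta>) \<le> nu / j * exp (\<tau> x)"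
              using pos by (auto intro!: mult_left_mono divide_right_mono)
            then have "norm x < exp (- T) + eps" "exp (- T) - eps < norm x"
              using elim(3,4) nx unfolding nu_def j_def by linarith+
            moreover have "\<bar>norm x - exp (- T)\<bar> \<ge> eps" using x unfolding h by (simp add: D_set_def)
            ultimately show False by linarith
          qed
          then have "C * (exp (- a0 * \<tau> x) * \<bar>f (\<tau> x)\<bar>) * m \<le> C * (\<eta> * (exp (- a0 * t0) * \<bar>f t0\<bar>)) * m"
            using C \<open>m > 0\<close> by (intro mult_right_mono mult_left_mono far) auto
          also have "\<dots> = \<eta> * \<bar>u x0\<bar>" unfolding u0 by simp
          finally show ?thesis using u_le[OF False] by linarith
        qed
      qed
      then show ?case using \<open>\<eta> < e\<close> by (simp add: u_def)
    qed
  qed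
qed

end
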